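(* Let $L>0$ and $T=nL$ for some $n\in\mathbb{N}$, which induces the time slices $((j-1)L,jL)$ for $j=1,\dots,n$. Let $\Sigma_H$ be a uniform mesh of $\Sigma$, and let $\Sigma_h$ be the fine mesh obtained by decomposing each element $\tau_\ell^H$ of $\Sigma_H$ into $m$ equal sized elements $\tau_k^h$, where $m\in\mathbb{N}$, $m>2$. Assume that $jL$, $j=0,\dots,n$, are nodes of the mesh $\Sigma_H$ at $x=0$ and at $x=L$, respectively. Then the Schur complement matrix $S_h^{nL} := V_h^\top D_h^{-1}V_h$ for $n$ time slices satisfies $$(S_h^{nL}\underline{w},\underline{w}) \ge 4\sin^2\left(\frac{\pi}{2(2n+1)}\right)\Big(\frac12-\frac1m\Big)^2\|w_H\|^2_{[H^1_{,0}(\Sigma)]'}\qquad\text{for all }\underline{w}\in\mathbb{R}^{N_H}\leftrightarrow w_H\in\mathcal{S}_H^0(\Sigma).$$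
   Context: All functions are real-valued. $L^2(\Sigma) := L^2(0,T)\times L^2(0,T)$ and $H^1_{,0}(\Sigma) := H^1_{,0}(0,T)\times H^1_{,0}(0,T)$, where $H^1_{,0}(0,T)=\{q\in H^1(0,T): q(T)=0\}$; elements are written $u=(u_0,u_L)$, with $\|u\|^2_{L^2(\Sigma)} = \|u_0\|^2_{L^2(0,T)}+\|u_L\|^2_{L^2(0,T)}$ and $\|u\|^2_{H^1_{,0}(\Sigma)} := \|\partial_t u_0\|^2_{L^2(0,T)}+\|\partial_t u_L\|^2_{L^2(0,T)}$. $[H^1_{,0}(\Sigma)]'$ is the dual of $H^1_{,0}(\Sigma)$ with respect to $L^2(\Sigma)$ (the pairing $\langle\cdot,\cdot\rangle_\Sigma$ extends the $L^2(\Sigma)$ inner product, so $L^2(\Sigma)\subset [H^1_{,0}(\Sigma)]'$), with norm $\|w\|_{[H^1_{,0}(\Sigma)]'} = \sup_{0\neq v\in H^1_{,0}(\Sigma)}\langle w,v\rangle_\Sigma/\|v\|_{H^1_{,0}(\Sigma)}$. The single layer boundary integral operator of the wave equation on $(0,L)\times(0,T)$ is, for $w=(w_0,w_L)\in L^2(\Sigma)$ and $t\in(0,T)$, $$(\mathsf{V}w)(t) = \begin{pmatrix} \frac12\int_0^t w_0(s)\,ds + \frac12\int_0^{t-L} w_L(s)\,ds\\[1mm] \frac12\int_0^{t-L} w_0(s)\,ds+\frac12\int_0^t w_L(s)\,ds\end{pmatrix},$$ where integrals $\int_0^{t-L}$ are understood as $0$ for $t\le L$. A mesh of $\Sigma$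 consists of a decomposition of $(0,T)$ into finitely many intervals (elements) for the component at $x=0$ and another decomposition of $(0,T)$ for the component at $x=L$; it is uniform if all elements (of both components) have the same length. $\mathcal{S}_H^0(\Sigma)=\mathrm{span}\{\phi_\ell\}_{\ell=1}^{N_H}$ and $\mathcal{S}_h^0(\Sigma)=\mathrm{span}\{\varphi_k\}_{k=1}^{N_h}$ are the spaces of piecewise constant functions on $\Sigma_H$ and $\Sigma_h$, where $\phi_\ell$ (resp. $\varphi_k$) is the indicator function of the element $\tau_\ell^H$ (resp. $\tau_k^h$) in the corresponding component, and zero in the other. The matrices are $D_h[j,k] = \langle\varphi_k,\varphi_j\rangle_{L^2(\Sigma)}$ ($j,k=1,\dots,N_h$) and $V_h[j,\ell] = \langle\mathsf{V}\phi_\ell,\varphi_j\rangle_{L^2(\Sigma)}$ ($j=1,\dots,N_h$, $\ell=1,\dots,N_H$). The correspondence $\underline{w}\leftrightarrow w_H$ means $w_H=\sum_{\ell=1}^{N_H} w_\ell\phi_\ell$, and $(\cdot,\cdot)$ is the Euclidean inner product on $\mathbb{R}^{N_H}$. *)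

theory Defs
  imports "HOL-Analysis.Analysis"
begin

section \<open>Function spaces on the interval and on the lateral boundary\<close>

text \<open>Functions on \<open>(0,T)\<close> are represented by total functions; only their values on \<open>[0,T]\<close> matter.\<close>

definition L2 :: "real \<Rightarrow> (real \<Rightarrow> real) set" where
  "L2 T = {f. set_borel_measurable lborel {0<..<T} f \<and>
              set_integrable lborel {0<..<T} (\<lambda>t. (f t)\<^sup>2)}"

definition L2_inner :: "real \<Rightarrow> (real \<Rightarrow> real) \<Rightarrow> (real \<Rightarrow> real) \<Rightarrow> real" where
  "L2_inner T f g = (LINT t:{0<..<T}|lborel. f t * g t)"

text \<open>\<open>\<phi> \<in> C\<^sub>c\<^sup>1(0,T)\<close> with derivative \<open>\<phi>'\<close>.\<close>

definition test_function :: "real \<Rightarrow> (real \<Rightarrow> real) \<Rightarrow> (real \<Rightarrow> real) \<Rightarrow> bool" where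
  "test_function T \<phi> \<phi>' \<longleftrightarrow>
     (\<forall>t. (\<phi> has_real_derivative \<phi>' t) (at t)) \<and> continuous_on UNIV \<phi>' \<and>
     (\<exists>a b. 0 < a \<and> b < T \<and> (\<forall>t. t \<notin> {a..b} \<longrightarrow> \<phi> t = 0))"

definition has_weak_deriv :: "real \<Rightarrow> (real \<Rightarrow> real) \<Rightarrow> (real \<Rightarrow> real) \<Rightarrow> bool" where
  "has_weak_deriv T q g \<longleftrightarrow> g \<in> L2 T \<and>
     (\<forall>\<phi> \<phi>'. test_function T \<phi> \<phi>' \<longrightarrow> L2_inner T q \<phi>' = - L2_inner T g \<phi>)"

definition H1 :: "real \<Rightarrow> (real \<Rightarrow> real) set" where
  "H1 T = {q \<in> L2 T. \<exists>g. has_weak_deriv T q g}"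

text \<open>The weak derivative is unique up to null sets, so that every choice gives the same
  \<open>L\<^sup>2\<close> norm.\<close>

definition weak_deriv :: "real \<Rightarrow> (real \<Rightarrow> real) \<Rightarrow> real \<Rightarrow> real" where
  "weak_deriv T q = (SOME g. has_weak_deriv T q g)"

text \<open>Every class in \<open>H\<^sup>1(0,T)\<close> has exactly one representative that is continuous on \<open>[0,T]\<close>;
  it is the one used here, which gives a meaning to the condition \<open>q(T) = 0\<close>.\<close>

definition H1_end0 :: "real \<Rightarrow> (real \<Rightarrow> real) set" where
  "H1_end0 T = {q \<in> H1 T. continuous_on {0..T} q \<and> q T = 0}"

text \<open>Functions on the boundary are pairs \<open>(u\<^sub>0, u\<^sub>L)\<close>.\<close>

type_synonym bfun = "(real \<Rightarrow> real) \<times> (real \<Rightarrow> real)"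

definition Sigma_inner :: "real \<Rightarrow> bfun \<Rightarrow> bfun \<Rightarrow> real" where
  "Sigma_inner T u v = L2_inner T (fst u) (fst v) + L2_inner T (snd u) (snd v)"

definition H1_Sigma :: "real \<Rightarrow> bfun set" where
  "H1_Sigma T = H1_end0 T \<times> H1_end0 T"

definition H1_Sigma_norm :: "real \<Rightarrow> bfun \<Rightarrow> real" where
  "H1_Sigma_norm T u =
     sqrt (L2_inner T (weak_deriv T (fst u)) (weak_deriv T (fst u)) +
           L2_inner T (weak_deriv T (snd u)) (weak_deriv T (snd u)))"

text \<open>Dual norm of a functional. A boundary function \<open>w\<close> in \<open>L\<^sup>2\<close> is identified with the functional
  \<open>Sigma_inner T w\<close>. For continuous representatives, being nonzero as an element of the space means
  being nonzero at some point of \<open>[0,T]\<close>.\<close>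

definition dual_norm :: "real \<Rightarrow> (bfun \<Rightarrow> real) \<Rightarrow> real" where
  "dual_norm T F =
     (SUP v \<in> {v \<in> H1_Sigma T. \<exists>t\<in>{0..T}. fst v t \<noteq> 0 \<or> snd v t \<noteq> 0}. F v / H1_Sigma_norm T v)"

section \<open>The single layer operator\<close>

text \<open>For \<open>t < L\<close> the set \<open>{0..t - L}\<close> is empty and the integral is \<open>0\<close>.\<close>

definition single_layer :: "real \<Rightarrow> bfun \<Rightarrow> bfun" where
  "single_layer L w =
     (\<lambda>t. 1/2 * (LINT s:{0..t}|lborel. fst w s) + 1/2 * (LINT s:{0..t - L}|lborel. snd w s),
      \<lambda>t. 1/2 * (LINT s:{0..t - L}|lborel. fst w s) + 1/2 * (LINT s:{0..t}|lborel. snd w s))"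

section \<open>Meshes, piecewise constant functions and matrices\<close>

datatype side = At_0 | At_L

text \<open>\<open>Elem c a b\<close> is the interval \<open>(a,b)\<close> in the component \<open>c\<close> of the boundary. A mesh is a family of
  elements indexed by a finite type, whose cardinality is the dimension of the space of piecewise
  constant functions.\<close>

datatype elem = Elem (elem_side: side) (lo: real) (hi: real)

definition mesh :: "real \<Rightarrow> ('i::finite \<Rightarrow> elem) \<Rightarrow> bool" where
  "mesh T \<tau> \<longleftrightarrow>
     (\<forall>i. lo (\<tau> i) < hi (\<tau> i)) \<and>
     (\<forall>i j. i \<noteq> j \<and> elem_side (\<tau> i) = elem_side (\<tau> j) \<longrightarrow>
        {lo (\<tau> i)<..<hi (\<tau> i)} \<inter> {lo (\<tau> j)<..<hi (\<tau> j)} = {}) \<and>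
     (\<forall>c. (\<Union>i\<in>{i. elem_side (\<tau> i) = c}. {lo (\<tau> i)..hi (\<tau> i)}) = {0..T})"

definition uniform_mesh :: "real \<Rightarrow> ('i::finite \<Rightarrow> elem) \<Rightarrow> bool" where
  "uniform_mesh T \<tau> \<longleftrightarrow> mesh T \<tau> \<and> (\<exists>d. \<forall>i. hi (\<tau> i) - lo (\<tau> i) = d)"

definition mesh_nodes :: "('i::finite \<Rightarrow> elem) \<Rightarrow> side \<Rightarrow> real set" where
  "mesh_nodes \<tau> c = (\<Union>i\<in>{i. elem_side (\<tau> i) = c}. {lo (\<tau> i), hi (\<tau> i)})"

definition subelem :: "nat \<Rightarrow> elem \<Rightarrow> nat \<Rightarrow> elem" where
  "subelem m e r =
     Elem (elem_side e) (lo e + real r * ((hi e - lo e) / real m))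
                        (lo e + real (Suc r) * ((hi e - lo e) / real m))"

definition equal_refinement :: "nat \<Rightarrow> ('i::finite \<Rightarrow> elem) \<Rightarrow> ('k::finite \<Rightarrow> elem) \<Rightarrow> bool" where
  "equal_refinement m \<tau> \<tau>' \<longleftrightarrow>
     inj \<tau>' \<and> range \<tau>' = {subelem m (\<tau> i) r | i r. r < m}"

definition elem_fun :: "elem \<Rightarrow> bfun" where
  "elem_fun e =
     (\<lambda>t. if elem_side e = At_0 then indicator {lo e<..<hi e} t else 0,
      \<lambda>t. if elem_side e = At_L then indicator {lo e<..<hi e} t else 0)"

definition pw_const :: "('i::finite \<Rightarrow> elem) \<Rightarrow> real^'i \<Rightarrow> bfun" where
  "pw_const \<tau> w =
     (\<lambda>t. \<Sum>i\<in>UNIV. w $ i * fst (elem_fun (\<tau> i)) t,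
      \<lambda>t. \<Sum>i\<in>UNIV. w $ i * snd (elem_fun (\<tau> i)) t)"

definition mass_matrix :: "real \<Rightarrow> ('k::finite \<Rightarrow> elem) \<Rightarrow> real^'k^'k" where
  "mass_matrix T \<tau>h = (\<chi> j k. Sigma_inner T (elem_fun (\<tau>h k)) (elem_fun (\<tau>h j)))"

definition single_layer_matrix ::
    "real \<Rightarrow> real \<Rightarrow> ('i::finite \<Rightarrow> elem) \<Rightarrow> ('k::finite \<Rightarrow> elem) \<Rightarrow> real^'i^'k" where
  "single_layer_matrix L T \<tau>H \<tau>h =
     (\<chi> j l. Sigma_inner T (single_layer L (elem_fun (\<tau>H l))) (elem_fun (\<tau>h j)))"

definition schur_matrix ::
    "real \<Rightarrow> real \<Rightarrow> ('i::finite \<Rightarrow> elem) \<Rightarrow> ('k::finite \<Rightarrow> elem) \<Rightarrow> real^'i^'i" where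
  "schur_matrix L T \<tau>H \<tau>h =
     transpose (single_layer_matrix L T \<tau>H \<tau>h) ** matrix_inv (mass_matrix T \<tau>h)
       ** single_layer_matrix L T \<tau>H \<tau>h"

end

theory Submission
  imports Defs
begin

text \<open>The Schur complement form is \<open>(S w, w) = \<Sum>\<^sub>k h\<^sub>k\<^sup>-\<^sup>1 (\<integral>\<^sub>k V w)\<^sup>2\<close>, the squared norm of the \<open>L\<^sup>2\<close> projection of \<open>V w\<close>
  onto the fine piecewise constants. As \<open>L\<close> is a multiple of the mesh size, \<open>V w\<close> is affine on
  every coarse element, and the projection keeps at least the fraction \<open>1 - 1/m\<^sup>2 \<ge> (1 - 2/m)\<^sup>2\<close> of its
  squared norm. With the antiderivatives \<open>P\<^sub>0, P\<^sub>L\<close> of the two components of \<open>w\<close>, integration by parts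
  bounds the dual norm by the \<open>L\<^sup>2\<close> norm of \<open>(P\<^sub>0, P\<^sub>L)\<close>, and \<open>V w\<close> has the components
  \<open>(P\<^sub>0(t) + P\<^sub>L(t - L))/2\<close> and \<open>(P\<^sub>L(t) + P\<^sub>0(t - L))/2\<close>. Sampling at \<open>t, t + L, \<dots>, t + (n - 1)L\<close> reduces the
  remaining estimate to a discrete Wirtinger inequality with one Dirichlet and one Neumann end, whose
  ground state is \<open>sin (j \<pi> / (2 n + 1))\<close>.\<close>

section \<open>A discrete Wirtinger inequality\<close>

text \<open>The constant comes from three places. The factors 1/2 in V cost 1/4, which cancels the 4
  in 4 sin^2(pi / (2 (2 n + 1))), the lowest eigenvalue of the discrete problem. The factor 4 in the
  claim belongs to the projection, as 4 (1/2 - 1/m)^2 = (1 - 2/m)^2. The discrete problem is coupled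
  and has plus signs: x_j + y_{j-1} and y_j + x_{j-1}. Multiplying both sequences by (-1)^j turns
  the sums into differences along two chains that alternate between x and y. Causality gives the
  Dirichlet end, since the antiderivatives vanish for t <= 0; nothing is prescribed at t = T, which
  gives the free end. The analytic obstacle is that H1 is known only through C^1 test functions and
  that the weak derivative is an arbitrary choice. Integration by parts therefore rests on showing
  that a continuous representative is the integral of any of its weak derivatives. The dual norm has
  to be bounded from above only, so Cauchy-Schwarz completes that half.\<close>

lemma pair_sum_square_picone:
  fixes a b s t :: real
  assumes "s > 0" "t > 0"
  shows "(a + b)\<^sup>2 \<ge> a\<^sup>2 * (1 - s / t) + b\<^sup>2 * (1 - t / s)"
proof -
  \<comment> \<open>The remainder in Picone's identity: a^2 s/t + 2 a b + b^2 t/s is this perfect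
    square. It vanishes exactly when a : b = t : -s, which is the alternating ground state.\<close>
  have "0 \<le> (a * s + b * t)\<^sup>2 / (s * t)" using assms by simp
  also have "\<dots> = (a + b)\<^sup>2 - (a\<^sup>2 * (1 - s / t) + b\<^sup>2 * (1 - t / s))"
    using assms by (simp add: field_simps power2_eq_square)
  finally show ?thesis by simp
qed

lemma sin_two_step:
  fixes \<theta> :: real
  shows "sin (real (k + 2) * \<theta>) = 2 * cos \<theta> * sin (real (k + 1) * \<theta>) - sin (real k * \<theta>)"
proof -
  define u where "u = real (k + 1) * \<theta>"
  have "real (k + 2) * \<theta> = u + \<theta>" "real k * \<theta> = u - \<theta>"
    by (simp_all add: u_def algebra_simps)
  then show ?thesis by (simp only: u_def[symmetric] sin_add sin_diff) simp
qed

text \<open>Picone's method: \<open>j \<mapsto> sin (j \<theta>)\<close> is a positive solution of the difference equation with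
  eigenvalue \<open>2 - 2 cos \<theta>\<close>.\<close>

lemma coupled_wirtinger_aux:
  fixes x y :: "nat \<Rightarrow> real" and \<theta> :: real
  assumes pos: "\<And>j. 1 \<le> j \<Longrightarrow> j \<le> n \<Longrightarrow> 0 < sin (real j * \<theta>)"
    and 0: "x 0 = 0" "y 0 = 0" and k: "1 \<le> k" "k \<le> n"
  shows "(2 - 2 * cos \<theta>) * (\<Sum>j=1..k. (x j)\<^sup>2 + (y j)\<^sup>2)
      - ((x k)\<^sup>2 + (y k)\<^sup>2) * (1 - sin (real (k + 1) * \<theta>) / sin (real k * \<theta>))
    \<le> (\<Sum>j=1..k. (x j + y (j - 1))\<^sup>2 + (y j + x (j - 1))\<^sup>2)"
  using k
proof (induction k rule: dec_induct)
  case base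
  \<comment> \<open>For k = 1 the terms with index 0 vanish, and sin(2\<theta>) / sin \<theta> = 2
    cos \<theta> makes the claim an equality.\<close>
  have "0 < sin \<theta>" using pos[of 1] k by simp
  moreover have "sin (2 * \<theta>) = 2 * cos \<theta> * sin \<theta>" by (simp add: sin_double)
  ultimately show ?case using 0 by (simp add: algebra_simps)
next
  case (step k)
  define s where "s = (\<lambda>j::nat. sin (real j * \<theta>))"
  define q where "q = (\<lambda>j. (x j)\<^sup>2 + (y j)\<^sup>2)"
  define e where "e = (x (Suc k) + y k)\<^sup>2 + (y (Suc k) + x k)\<^sup>2"
  define S where "S = (\<Sum>j=1..k. (x j)\<^sup>2 + (y j)\<^sup>2)"
  have p: "0 < s k" "0 < s (Suc k)" using pos[of k] pos[of "Suc k"] step by (auto simp: s_def)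
  have "s (k + 2) = 2 * cos \<theta> * s (Suc k) - s k" using sin_two_step[of k \<theta>] by (simp add: s_def)
  \<comment> \<open>The recursion turns the weight of the new index into the eigenvalue minus the
    next boundary term. The weight of the old index is what cancels the previous boundary term, so
    the sum telescopes.\<close>
  then have *: "1 - s k / s (Suc k) = (2 - 2 * cos \<theta>) - (1 - s (k + 2) / s (Suc k))"
    using p by (simp add: field_simps)
  have "q (Suc k) * (1 - s k / s (Suc k)) + q k * (1 - s (Suc k) / s k) \<le> e"
    using pair_sum_square_picone[OF p, of "x (Suc k)" "y k"]
      pair_sum_square_picone[OF p, of "y (Suc k)" "x k"]
    unfolding q_def e_def distrib_right by linarith
  then have "(2 - 2 * cos \<theta>) * q (Suc k) - q (Suc k) * (1 - s (k + 2) / s (Suc k))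
      + q k * (1 - s (Suc k) / s k) \<le> e"
    unfolding * by (simp add: algebra_simps)
  moreover have "(2 - 2 * cos \<theta>) * S - q k * (1 - s (Suc k) / s k)
      \<le> (\<Sum>j=1..k. (x j + y (j - 1))\<^sup>2 + (y j + x (j - 1))\<^sup>2)"
    using step by (simp add: s_def S_def q_def)
  ultimately have "(2 - 2 * cos \<theta>) * (S + q (Suc k)) - q (Suc k) * (1 - s (k + 2) / s (Suc k))
     \<le> (\<Sum>j=1..k. (x j + y (j - 1))\<^sup>2 + (y j + x (j - 1))\<^sup>2) + e"
    unfolding distrib_left by linarith
  then show ?case by (simp add: s_def S_def q_def e_def)
qed

text \<open>The angle \<theta> = pi / (2 n + 1) is chosen so that the boundary term left over at k =
  n disappears while sin(j \<theta>) stays positive for j = 1, ..., n. The factor is 2 - 2 cos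
  \<theta> rewritten by the half-angle formula.\<close>

lemma coupled_wirtinger:
  fixes x y :: "nat \<Rightarrow> real"
  assumes "x 0 = 0" "y 0 = 0"
  shows "4 * (sin (pi / (2 * (2 * real n + 1))))\<^sup>2 * (\<Sum>j=1..n. (x j)\<^sup>2 + (y j)\<^sup>2)
    \<le> (\<Sum>j=1..n. (x j + y (j - 1))\<^sup>2 + (y j + x (j - 1))\<^sup>2)"
proof (cases "n = 0")
  case False
  define \<theta> where "\<theta> = pi / (2 * real n + 1)"
  have pos: "0 < sin (real j * \<theta>)" if "1 \<le> j" "j \<le> n" for j
  proof (rule sin_gt_zero)
    show "0 < real j * \<theta>" using that by (simp add: \<theta>_def)
    have "real j * pi < (2 * real n + 1) * pi" using that by simp
    then show "real j * \<theta> < pi" by (simp add: \<theta>_def field_simps)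
  qed
  \<comment> \<open>n \<theta> and (n + 1) \<theta> lie symmetrically about pi/2, so the ground
    state takes equal values there: the discrete Neumann condition.\<close>
  have "real (n + 1) * \<theta> = pi - real n * \<theta>" by (simp add: \<theta>_def field_simps)
  then have "sin (real (n + 1) * \<theta>) = sin (real n * \<theta>)" by simp
  moreover have "0 < sin (real n * \<theta>)" using pos False by simp
  ultimately have "1 - sin (real (n + 1) * \<theta>) / sin (real n * \<theta>) = 0" by simp
  moreover have "2 - 2 * cos \<theta> = 4 * (sin (pi / (2 * (2 * real n + 1))))\<^sup>2"
  proof -
    have "pi / (2 * (2 * real n + 1)) = \<theta> / 2" by (simp add: \<theta>_def)
    show ?thesis unfolding \<open>_ = \<theta> / 2\<close> using cos_double_sin[of "\<theta> / 2"] by simp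
  qed
  ultimately show ?thesis
    using coupled_wirtinger_aux[where k = n and n = n and \<theta> = \<theta>, of x y] pos assms False
    by (simp only:) simp
qed simp

section \<open>Weak derivatives and the dual norm\<close>

lemma L2_mult_set_integrable:
  assumes "f \<in> L2 T" "g \<in> L2 T"
  shows "set_integrable lborel {0<..<T} (\<lambda>t. f t * g t)"
proof (rule set_integrable_bound)
  show "set_integrable lborel {0<..<T} (\<lambda>t. (f t)\<^sup>2 + (g t)\<^sup>2)"
    using assms by (auto simp: L2_def)
  \<comment> \<open>Measurability is known only after cutting off outside (0,T), so the indicator is
    attached to each factor separately; it is idempotent.\<close>
  have "(\<lambda>t. (indicator {0<..<T} t * f t) * (indicator {0<..<T} t * g t)) \<in> borel_measurable lborel"
    using assms unfolding L2_def set_borel_measurable_def real_scaleR_def mem_Collect_eq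
    by (intro borel_measurable_times[of "\<lambda>t. indicator {0<..<T} t * f t" _ "\<lambda>t. indicator {0<..<T} t * g t"]) blast+
  also have "(\<lambda>t. (indicator {0<..<T} t * f t) * (indicator {0<..<T} t * g t)) =
      (\<lambda>t. indicator {0<..<T} t * (f t * g t))"
    by (auto simp: indicator_def)
  finally show "set_borel_measurable lborel {0<..<T} (\<lambda>t. f t * g t)"
    by (simp add: set_borel_measurable_def)
  have "\<bar>a * b\<bar> \<le> a\<^sup>2 + b\<^sup>2" for a b :: real
    using sum_squares_bound[of a b] sum_squares_bound[of a "-b"] zero_le_power2[of a] zero_le_power2[of b] by (auto simp: abs_if)
  then show "AE x in lborel. x \<in> {0<..<T} \<longrightarrow> norm (f x * g x) \<le> norm ((f x)\<^sup>2 + (g x)\<^sup>2)"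
    by (auto simp: abs_mult)
qed

lemma continuous_on_imp_L2:
  assumes "continuous_on {0..T} f"
  shows "f \<in> L2 T"
proof -
  have "set_integrable lborel {0<..<T} f"
    by (rule set_integrable_subset[OF borel_integrable_atLeastAtMost'[OF assms]]) auto
  moreover have "set_integrable lborel {0<..<T} (\<lambda>t. (f t)\<^sup>2)"
    by (rule set_integrable_subset[OF borel_integrable_atLeastAtMost'])
      (auto intro!: continuous_intros assms)
  ultimately show ?thesis
    by (auto simp: L2_def set_integrable_def set_borel_measurable_def dest: borel_measurable_integrable)
qed

lemma L2_set_integrable:
  assumes "f \<in> L2 T"
  shows "set_integrable lborel {0<..<T} f"
  using L2_mult_set_integrable[OF assms continuous_on_imp_L2[of T "\<lambda>_. 1"]] by simp

lemma L2_inner_diff_right: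
  assumes "f \<in> L2 T" "g \<in> L2 T" "h \<in> L2 T"
  shows "L2_inner T f (\<lambda>t. g t - h t) = L2_inner T f g - L2_inner T f h"
  using set_integral_diff(2)[OF L2_mult_set_integrable[OF assms(1,2)] L2_mult_set_integrable[OF assms(1,3)]]
  by (simp add: L2_inner_def right_diff_distrib)

section \<open>Piecewise quadratic C^1 steps and the bumps that are their derivatives\<close>

lemma DERIV_max_0_square:
  "((\<lambda>x::real. (max 0 x)\<^sup>2) has_real_derivative 2 * max 0 x) (at x)"
proof (cases x "0::real" rule: linorder_cases)
  case less
  have "((\<lambda>_::real. 0::real) has_real_derivative 2 * max 0 x) (at x)"
    using less by (simp add: max_def)
  then show ?thesis
    by (rule has_field_derivative_transform_within_open[where S = "{..<0}"])
      (use less in \<open>auto simp: max_def\<close>)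
next
  case greater
  have "((\<lambda>x::real. x\<^sup>2) has_real_derivative 2 * x) (at x)"
    by (auto intro!: derivative_eq_intros)
  then have "((\<lambda>x::real. (max 0 x)\<^sup>2) has_real_derivative 2 * x) (at x)"
    by (rule has_field_derivative_transform_within_open[where S = "{0<..}"])
      (use greater in \<open>auto simp: max_def\<close>)
  then show ?thesis using greater by (simp add: max_def)
next
  case equal
  have "((\<lambda>h::real. max 0 h) \<longlongrightarrow> max 0 0) (at 0)"
    by (intro tendsto_intros)
  moreover have "(max 0 h)\<^sup>2 / h = max 0 h" for h :: real
    by (auto simp: max_def power2_eq_square)
  ultimately show ?thesis using equal by (simp add: DERIV_def)
qed

text \<open>The triangle over [0,1] with peak 2 at 1/2, hence of area 1. Test functions are only
  required to be C^1, so a continuous piecewise linear derivative is enough;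
  \<open>smooth_step\<close> is the antiderivative that rises from 0 to 1 on [0,1].\<close>

definition hat :: "real \<Rightarrow> real" where
  "hat x = 4 * max 0 x - 8 * max 0 (x - 1/2) + 4 * max 0 (x - 1)"

definition smooth_step :: "real \<Rightarrow> real" where
  "smooth_step x = 2 * (max 0 x)\<^sup>2 - 4 * (max 0 (x - 1/2))\<^sup>2 + 2 * (max 0 (x - 1))\<^sup>2"

lemma hat_nonneg: "0 \<le> hat x"
  and hat_eq_0: "x \<notin> {0..1} \<Longrightarrow> hat x = 0"
  by (auto simp: hat_def max_def)

lemma continuous_on_hat [continuous_intros]:
  "continuous_on A f \<Longrightarrow> continuous_on A (\<lambda>x. hat (f x))"
  unfolding hat_def by (intro continuous_intros)

lemma DERIV_smooth_step: "(smooth_step has_real_derivative hat x) (at x)"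
proof -
  have *: "((\<lambda>x::real. (max 0 (x - c))\<^sup>2) has_real_derivative 2 * max 0 (x - c)) (at x)" for c
    using DERIV_chain2[OF DERIV_max_0_square, of "\<lambda>x. x - c" 1 x]
    by (simp add: DERIV_diff[OF DERIV_ident DERIV_const, simplified])
  show ?thesis unfolding smooth_step_def[abs_def] hat_def
    using DERIV_add[OF DERIV_diff[OF DERIV_cmult[OF *[of 0], of 2] DERIV_cmult[OF *[of "1/2"], of 4]]
        DERIV_cmult[OF *[of 1], of 2]]
    by simp
qed

lemma smooth_step_eq_0: "x \<le> 0 \<Longrightarrow> smooth_step x = 0"
  by (simp add: smooth_step_def)

lemma smooth_step_eq_1: "1 \<le> x \<Longrightarrow> smooth_step x = 1"
  by (simp add: smooth_step_def max_def power2_eq_square algebra_simps)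

lemma smooth_step_bounds: "0 \<le> smooth_step x" "smooth_step x \<le> 1"
proof -
  have mono: "a \<le> b \<Longrightarrow> smooth_step a \<le> smooth_step b" for a b
    by (rule DERIV_nonneg_imp_nondecreasing[of a b smooth_step])
      (auto intro: DERIV_smooth_step hat_nonneg)
  show "0 \<le> smooth_step x" using mono[of "min 0 x" x] by (simp add: smooth_step_eq_0)
  show "smooth_step x \<le> 1" using mono[of x "max 1 x"] by (simp add: smooth_step_eq_1)
qed

lemma has_bochner_integral_hat: "has_bochner_integral lborel hat 1"
proof -
  have eq: "(\<lambda>x. indicator {0..1} x *\<^sub>R hat x) = hat"
  proof
    show "indicator {0..1} x *\<^sub>R hat x = hat x" for x
      using hat_eq_0[of x] by (cases "x \<in> {0..1}") auto
  qed
  have "has_bochner_integral lborel (\<lambda>x. indicator {0..1} x *\<^sub>R hat x) 1"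
  proof (subst has_bochner_integral_iff, intro conjI)
    show "integrable lborel (\<lambda>x. indicator {0..1} x *\<^sub>R hat x)"
      by (intro borel_integrable_compact continuous_intros) auto
    have "(\<integral>x. indicator {0..1} x *\<^sub>R hat x \<partial>lborel) = smooth_step 1 - smooth_step 0"
      by (rule integral_FTC_atLeastAtMost)
        (simp_all add: continuous_on_hat has_real_derivative_iff_has_vector_derivative[symmetric]
          has_field_derivative_at_within[OF DERIV_smooth_step])
    then show "(\<integral>x. indicator {0..1} x *\<^sub>R hat x \<partial>lborel) = 1"
      by (simp add: smooth_step_eq_0 smooth_step_eq_1)
  qed
  then show ?thesis by (simp only: eq)
qed

text \<open>The scaled bumps form an approximate identity. Substituting x = K (t - s) + c moves the
  scaling into the argument of \<open>v\<close>, and dominated convergence applies with a multiple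
  of \<open>hat\<close> as majorant. The free offset c lets the bump sit on either side of
  s.\<close>

lemma L2_inner_hat_tendsto:
  assumes v: "continuous_on {0..T} v" and s: "0 < s" "s < T"
  shows "(\<lambda>k. L2_inner T v (\<lambda>t. real (Suc k) * hat (real (Suc k) * (t - s) + c))) \<longlonglongrightarrow> v s"
proof -
  \<comment> \<open>Extension by zero: for small k the scaled argument may leave (0,T).\<close>
  define F where "F = (\<lambda>t. indicator {0<..<T} t * v t)"
  have F_meas[measurable]: "F \<in> borel_measurable borel"
    using L2_set_integrable[OF continuous_on_imp_L2[OF v]]
    by (auto simp: set_integrable_def F_def dest: borel_measurable_integrable)
  have "bounded (v ` {0..T})"
    by (intro compact_imp_bounded compact_continuous_image v compact_Icc)
  then obtain M where M: "\<And>t. t \<in> {0..T} \<Longrightarrow> \<bar>v t\<bar> \<le> M"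
    unfolding bounded_iff real_norm_def by blast
  then have M0: "0 \<le> M" using s by (meson abs_ge_zero atLeastAtMost_iff less_imp_le order_trans)
  have FM: "\<bar>F t\<bar> \<le> M" for t using M[of t] M0 by (auto simp: F_def indicator_def)
  have cont: "isCont F s"
  proof -
    have "continuous_on {0<..<T} F"
    proof (subst continuous_on_cong)
      show "continuous_on {0<..<T} v" by (rule continuous_on_subset[OF v]) auto
    qed (auto simp: F_def)
    then show ?thesis using s by (auto simp: continuous_on_eq_continuous_at)
  qed
  have eq: "L2_inner T v (\<lambda>t. real (Suc k) * hat (real (Suc k) * (t - s) + c))
      = (\<integral>x. F (s + (x - c) / real (Suc k)) * hat x \<partial>lborel)" for k
  proof -
    define K where "K = real (Suc k)"
    have "K > 0" by (simp add: K_def)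
    have "L2_inner T v (\<lambda>t. K * hat (K * (t - s) + c))
        = (\<integral>t. F t * (K * hat (K * (t - s) + c)) \<partial>lborel)"
      by (simp add: L2_inner_def set_lebesgue_integral_def F_def mult.assoc)
    also have "\<dots> = \<bar>1 / K\<bar> *\<^sub>R (\<integral>x. F ((s - c / K) + (1 / K) * x) *
        (K * hat (K * (((s - c / K) + (1 / K) * x) - s) + c)) \<partial>lborel)"
      by (rule lborel_integral_real_affine) (use \<open>K > 0\<close> in simp)
    also have "\<dots> = (\<integral>x. \<bar>1 / K\<bar> * (F ((s - c / K) + (1 / K) * x) *
        (K * hat (K * (((s - c / K) + (1 / K) * x) - s) + c))) \<partial>lborel)"
      by (simp only: integral_mult_right_zero real_scaleR_def)
    also have "\<dots> = (\<integral>x. F (s + (x - c) / K) * hat x \<partial>lborel)"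
    proof (rule Bochner_Integration.integral_cong[OF refl])
      fix x
      have "(s - c / K) + (1 / K) * x = s + (x - c) / K"
        "K * (((s - c / K) + (1 / K) * x) - s) + c = x"
        using \<open>K > 0\<close> by (simp_all add: field_simps)
      then show "\<bar>1 / K\<bar> * (F ((s - c / K) + (1 / K) * x) *
          (K * hat (K * (((s - c / K) + (1 / K) * x) - s) + c))) = F (s + (x - c) / K) * hat x"
        using \<open>K > 0\<close> by (simp only:) simp
    qed
    finally show ?thesis unfolding K_def .
  qed
  have hat_meas[measurable]: "hat \<in> borel_measurable borel"
    using borel_measurable_continuous_onI[OF continuous_on_hat[OF continuous_on_id]] by simp
  have "(\<lambda>k. \<integral>x. F (s + (x - c) / real (Suc k)) * hat x \<partial>lborel) \<longlonglongrightarrow> (\<integral>x. F s * hat x \<partial>lborel)"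
  proof (rule integral_dominated_convergence[where w = "\<lambda>x. M * hat x"])
    show "integrable lborel (\<lambda>x. M * hat x)"
      using has_bochner_integral_hat by (auto simp: has_bochner_integral_iff)
    show "AE x in lborel. (\<lambda>k. F (s + (x - c) / real (Suc k)) * hat x) \<longlonglongrightarrow> F s * hat x"
    proof (intro AE_I2 tendsto_intros isCont_tendsto_compose[OF cont])
      fix x
      have "(\<lambda>k. (x - c) * inverse (real (Suc k))) \<longlonglongrightarrow> (x - c) * 0"
        by (intro tendsto_mult tendsto_const LIMSEQ_inverse_real_of_nat)
      then have "(\<lambda>k. s + (x - c) * inverse (real (Suc k))) \<longlonglongrightarrow> s + (x - c) * 0"
        by (rule tendsto_add[OF tendsto_const])
      then show "(\<lambda>k. s + (x - c) / real (Suc k)) \<longlonglongrightarrow> s"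
        by (simp only: divide_inverse mult_zero_right add_0_right)
    qed
    show "AE x in lborel. norm (F (s + (x - c) / real (Suc k)) * hat x) \<le> M * hat x" for k
      using FM hat_nonneg by (auto simp: abs_mult intro!: mult_mono M0)
  qed measurable
  moreover have "(\<integral>x. F s * hat x \<partial>lborel) = v s"
    using has_bochner_integral_hat s by (simp add: has_bochner_integral_iff F_def)
  ultimately show ?thesis by (simp only: eq)
qed

text \<open>The test functions are \<open>C\<^sup>1\<close> approximations of the indicator of \<open>(s, r)\<close>; their derivatives
  concentrate at \<open>s\<close> and \<open>r\<close>.\<close>

lemma weak_deriv_FTC_open:
  assumes v: "continuous_on {0..T} v" and g: "has_weak_deriv T v g"
    and sr: "0 < s" "s < r" "r < T"
  shows "v r - v s = (LINT t:{s..r}|lborel. g t)"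
proof -
  define G where "G = (\<lambda>t. indicator {0<..<T} t * g t)"
  have gL2: "g \<in> L2 T" and weak: "\<And>\<phi> \<phi>'. test_function T \<phi> \<phi>' \<Longrightarrow> L2_inner T v \<phi>' = - L2_inner T g \<phi>"
    using g by (auto simp: has_weak_deriv_def)
  have G_int: "integrable lborel G"
    using L2_set_integrable[OF gL2] by (simp add: set_integrable_def G_def)
  \<comment> \<open>With K = k + 1, the first step rises on [s, s + 1/K] and the second on
    [r - 1/K, r]. The offsets 0 and 1 place both transitions inside [s, r].\<close>
  define \<phi> where "\<phi> = (\<lambda>k t. smooth_step (real (Suc k) * (t - s) + 0) - smooth_step (real (Suc k) * (t - r) + 1))"
  define \<phi>' where "\<phi>' = (\<lambda>k t. real (Suc k) * hat (real (Suc k) * (t - s) + 0)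
      - real (Suc k) * hat (real (Suc k) * (t - r) + 1))"
  have vL2: "v \<in> L2 T" by (rule continuous_on_imp_L2[OF v])
  have hatL2: "(\<lambda>t. a * hat (a * (t - b) + c)) \<in> L2 T" for a b c
    by (intro continuous_on_imp_L2 continuous_intros)
  have lhs: "L2_inner T v (\<phi>' k) = L2_inner T v (\<lambda>t. real (Suc k) * hat (real (Suc k) * (t - s) + 0))
     - L2_inner T v (\<lambda>t. real (Suc k) * hat (real (Suc k) * (t - r) + 1))" for k
    unfolding \<phi>'_def by (rule L2_inner_diff_right[OF vL2 hatL2 hatL2])
  have "(\<lambda>k. L2_inner T v (\<phi>' k)) \<longlonglongrightarrow> v s - v r"
    unfolding lhs using sr by (intro tendsto_diff L2_inner_hat_tendsto[OF v]) auto
  moreover have "(\<lambda>k. L2_inner T g (\<phi> k)) \<longlonglongrightarrow> (LINT t:{s..r}|lborel. g t)"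
  proof -
    have "(\<lambda>k. \<integral>t. G t * \<phi> k t \<partial>lborel) \<longlonglongrightarrow> (\<integral>t. G t * indicator {s<..<r} t \<partial>lborel)"
    proof (rule integral_dominated_convergence[where w = "\<lambda>t. \<bar>G t\<bar>"])
      have [measurable]: "G \<in> borel_measurable borel"
        using G_int by (auto dest: borel_measurable_integrable)
      show "(\<lambda>t. G t * indicator {s<..<r} t) \<in> borel_measurable lborel" by measurable
      have [measurable]: "smooth_step \<in> borel_measurable borel"
        by (intro borel_measurable_continuous_onI)
          (auto simp: smooth_step_def[abs_def] intro!: continuous_intros)
      show "(\<lambda>t. G t * \<phi> k t) \<in> borel_measurable lborel" for k unfolding \<phi>_def by measurable
      show "integrable lborel (\<lambda>t. \<bar>G t\<bar>)" using G_int by auto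
      have "\<bar>\<phi> k t\<bar> \<le> 1" for k t
        using smooth_step_bounds[of "real (Suc k) * (t - s) + 0"]
          smooth_step_bounds[of "real (Suc k) * (t - r) + 1"]
        unfolding \<phi>_def by linarith
      then show "AE t in lborel. norm (G t * \<phi> k t) \<le> \<bar>G t\<bar>" for k
        by (auto simp: abs_mult intro!: mult_left_le)
      show "AE t in lborel. (\<lambda>k. G t * \<phi> k t) \<longlonglongrightarrow> G t * indicator {s<..<r} t"
      proof (intro AE_I2 tendsto_mult tendsto_const)
        fix t
        have below: "eventually (\<lambda>k. smooth_step (real (Suc k) * (t - a) + c) = 0) sequentially"
          if "t < a" for a c
        proof -
          have "filterlim (\<lambda>k. real (Suc k) * (a - t)) at_top sequentially"
            using that by (intro filterlim_at_top_mult_tendsto_pos[OF tendsto_const])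
              (auto intro!: filterlim_compose[OF filterlim_real_sequentially filterlim_Suc] simp del: of_nat_Suc)
          then have "eventually (\<lambda>k. c \<le> real (Suc k) * (a - t)) sequentially"
            by (simp add: filterlim_at_top)
          then show ?thesis
            by eventually_elim (rule smooth_step_eq_0, simp add: algebra_simps)
        qed
        have above: "eventually (\<lambda>k. smooth_step (real (Suc k) * (t - a) + c) = 1) sequentially"
          if "a < t" for a c
        proof -
          have "filterlim (\<lambda>k. real (Suc k) * (t - a)) at_top sequentially"
            using that by (intro filterlim_at_top_mult_tendsto_pos[OF tendsto_const])
              (auto intro!: filterlim_compose[OF filterlim_real_sequentially filterlim_Suc] simp del: of_nat_Suc)
          then have "eventually (\<lambda>k. 1 - c \<le> real (Suc k) * (t - a)) sequentially"
            by (simp add: filterlim_at_top)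
          then show ?thesis
            by eventually_elim (rule smooth_step_eq_1, simp add: algebra_simps)
        qed
        \<comment> \<open>At s and r the arguments are constant in k, with values 0 and 1; so
          convergence holds at every t, endpoints included.\<close>
        have at_s: "smooth_step (real (Suc k) * (s - s) + 0) = 0"
          and at_r: "smooth_step (real (Suc k) * (r - r) + 1) = 1" for k
          by (simp_all add: smooth_step_eq_0 smooth_step_eq_1)
        have "eventually (\<lambda>k. \<phi> k t = indicator {s<..<r} t) sequentially"
        proof -
          consider "t < s" "t < r" | "t = s" "t < r" | "s < t" "t < r" | "s < t" "t = r" | "s < t" "r < t"
            using sr by linarith
          then show ?thesis
          proof cases
            case 1 show ?thesis using below[OF 1(1), of 0] below[OF 1(2), of 1]
              by eventually_elim (use 1 in \<open>auto simp: \<phi>_def simp del: of_nat_Suc\<close>)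
          next
            case 2 show ?thesis using below[OF 2(2), of 1]
              by eventually_elim (use 2 at_s in \<open>auto simp: \<phi>_def simp del: of_nat_Suc\<close>)
          next
            case 3 show ?thesis using above[OF 3(1), of 0] below[OF 3(2), of 1]
              by eventually_elim (use 3 in \<open>auto simp: \<phi>_def simp del: of_nat_Suc\<close>)
          next
            case 4 show ?thesis using above[OF 4(1), of 0]
              by eventually_elim (use 4 at_r in \<open>auto simp: \<phi>_def simp del: of_nat_Suc\<close>)
          next
            case 5 show ?thesis using above[OF 5(1), of 0] above[OF 5(2), of 1]
              by eventually_elim (use 5 in \<open>auto simp: \<phi>_def simp del: of_nat_Suc\<close>)
          qed
        qed
        then show "(\<lambda>k. \<phi> k t) \<longlonglongrightarrow> indicator {s<..<r} t" by (rule tendsto_eventually)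
      qed
    qed
    moreover have "(\<integral>t. G t * indicator {s<..<r} t \<partial>lborel) = (LINT t:{s..r}|lborel. g t)"
      unfolding set_lebesgue_integral_def
    proof (rule integral_cong_AE)
      show "AE t in lborel. G t * indicator {s<..<r} t = indicator {s..r} t *\<^sub>R g t"
        using AE_lborel_singleton[of s] AE_lborel_singleton[of r]
        by eventually_elim (use sr in \<open>auto simp: G_def indicator_def\<close>)
      show "(\<lambda>t. G t * indicator {s<..<r} t) \<in> borel_measurable lborel"
        using borel_measurable_integrable[OF G_int] by measurable
      have "set_integrable lborel {s..r} g"
        by (rule set_integrable_subset[OF L2_set_integrable[OF gL2]]) (use sr in auto)
      then show "(\<lambda>t. indicator {s..r} t *\<^sub>R g t) \<in> borel_measurable lborel"
        by (auto simp: set_integrable_def dest: borel_measurable_integrable)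
    qed
    ultimately show ?thesis
      by (simp add: L2_inner_def set_lebesgue_integral_def G_def mult.assoc)
  qed
  moreover have "eventually (\<lambda>k. L2_inner T v (\<phi>' k) = - L2_inner T g (\<phi> k)) sequentially"
  proof -
    \<comment> \<open>Once K (r - s) >= 1, the second transition starts no earlier than s. Only then
      does the function vanish outside [s, r] and qualify as a test function.\<close>
    have "filterlim (\<lambda>k. real (Suc k) * (r - s)) at_top sequentially"
      using sr by (intro filterlim_at_top_mult_tendsto_pos[OF tendsto_const])
        (auto intro!: filterlim_compose[OF filterlim_real_sequentially filterlim_Suc] simp del: of_nat_Suc)
    then have "eventually (\<lambda>k. 1 \<le> real (Suc k) * (r - s)) sequentially"
      by (simp add: filterlim_at_top)
    then show ?thesis
    proof eventually_elim
      fix k assume k: "1 \<le> real (Suc k) * (r - s)"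
      define K where "K = real (Suc k)"
      have K: "K > 0" by (simp add: K_def)
      have "test_function T (\<phi> k) (\<phi>' k)"
        unfolding test_function_def
      proof (intro conjI allI)
        have *: "((\<lambda>t. smooth_step (K * (t - b) + c)) has_real_derivative K * hat (K * (t - b) + c)) (at t)"
          for t b c
        proof -
          have "((\<lambda>t. K * (t - b) + c) has_real_derivative K) (at t)"
            by (auto intro!: derivative_eq_intros)
          then show ?thesis
            using DERIV_chain2[OF DERIV_smooth_step, of "\<lambda>t. K * (t - b) + c" K t] by (simp add: mult.commute)
        qed
        show "(\<phi> k has_real_derivative \<phi>' k t) (at t)" for t
          unfolding \<phi>_def \<phi>'_def K_def[symmetric] by (intro DERIV_diff *)
        show "continuous_on UNIV (\<phi>' k)" unfolding \<phi>'_def by (intro continuous_intros)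
        have "\<phi> k t = 0" if out: "t \<notin> {s..r}" for t
        proof -
          consider "t < s" | "r < t" using out by fastforce
          then show ?thesis
          proof cases
            case 1
            have "K * (t - s) \<le> 0" using 1 K by (simp add: mult_le_0_iff)
            moreover have "K * (t - r) + 1 = K * (t - s) + (1 - K * (r - s))" by (simp add: algebra_simps)
            ultimately show ?thesis using k unfolding \<phi>_def K_def[symmetric]
              by (simp add: smooth_step_eq_0)
          next
            case 2
            have "0 \<le> K * (t - r)" using 2 K by simp
            moreover have "K * (t - s) = K * (t - r) + K * (r - s)" by (simp add: algebra_simps)
            ultimately show ?thesis using k unfolding \<phi>_def K_def[symmetric]
              by (simp add: smooth_step_eq_1)
          qed
        qed
        then show "\<exists>a b. 0 < a \<and> b < T \<and> (\<forall>t. t \<notin> {a..b} \<longrightarrow> \<phi> k t = 0)"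
          using sr by blast
      qed
      then show "L2_inner T v (\<phi>' k) = - L2_inner T g (\<phi> k)" by (rule weak)
    qed
  qed
  ultimately have "(\<lambda>k. - L2_inner T g (\<phi> k)) \<longlonglongrightarrow> v s - v r"
    "(\<lambda>k. - L2_inner T g (\<phi> k)) \<longlonglongrightarrow> - (LINT t:{s..r}|lborel. g t)"
    by (auto elim: Lim_transform_eventually intro!: tendsto_minus)
  then have "v s - v r = - (LINT t:{s..r}|lborel. g t)" by (rule LIMSEQ_unique)
  then show ?thesis by simp
qed

text \<open>The identity between interior points is continued to r = T, since both \<open>v\<close>
  and the indefinite integral of \<open>g\<close> are continuous up to T. This is where the end
  condition of the space enters.\<close>

lemma weak_deriv_FTC_end0:
  assumes v: "continuous_on {0..T} v" "v T = 0" and g: "has_weak_deriv T v g" and s: "0 < s" "s < T"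
  shows "v s = - (LINT t:{s..<T}|lborel. g t)"
proof -
  have L: "set_integrable lborel {s..<T} g"
    by (rule set_integrable_subset[OF L2_set_integrable]) (use g s in \<open>auto simp: has_weak_deriv_def\<close>)
  have "g integrable_on {s..<T}" using set_borel_integral_eq_integral(1)[OF L] .
  then have int: "g integrable_on {s..T}"
    by (rule integrable_spike_set) (auto intro: negligible_subset[of "{T}"])
  have "v x - v s - integral {s..x} g = 0" if "x \<in> {s<..<T}" for x
  proof -
    have "set_integrable lborel {s..x} g"
      by (rule set_integrable_subset[OF L]) (use that in auto)
    then show ?thesis
      using weak_deriv_FTC_open[OF v(1) g, of s x] s that by (simp add: set_borel_integral_eq_integral)
  qed
  moreover have "continuous_on {s..T} (\<lambda>x. v x - v s - integral {s..x} g)"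
    using s by (intro continuous_intros indefinite_integral_continuous_1 int continuous_on_subset[OF v(1)]) auto
  ultimately have "v T - v s - integral {s..T} g = 0"
    using s continuous_constant_on_closure[of "{s<..<T}" "\<lambda>x. v x - v s - integral {s..x} g" 0 T] by simp
  moreover have "integral {s..T} g = integral {s..<T} g"
    by (rule integral_spike_set) (auto intro: negligible_subset[of "{T}"])
  ultimately show ?thesis
    using v(2) by (simp add: set_borel_integral_eq_integral[OF L])
qed

text \<open>Writing v(s) as minus the integral of \<open>g\<close> over (s, T) and applying Fubini
  on the triangle s <= t replaces a product rule, so \<open>u\<close> may be merely integrable.
  Boundary terms are absent because the integral of \<open>u\<close> starts at 0 and
  \<open>v\<close> vanishes at T.\<close>

lemma L2_inner_weak_deriv_by_parts:
  assumes v: "continuous_on {0..T} v" "v T = 0" and g: "has_weak_deriv T v g"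
    and u: "set_integrable lborel {0<..<T} u"
  shows "L2_inner T u v = - L2_inner T (\<lambda>t. LINT s:{0..t}|lborel. u s) g"
proof -
  define U where "U = (\<lambda>t. indicator {0<..<T} t * u t)"
  define G where "G = (\<lambda>t. indicator {0<..<T} t * g t)"
  define k where "k = (\<lambda>s t. U s * G t * indicator {(s, t). s \<le> t} (s, t))"
  have gint: "set_integrable lborel {0<..<T} g"
    using g by (auto simp: has_weak_deriv_def intro: L2_set_integrable)
  have U_int: "integrable lborel U" and G_int: "integrable lborel G"
    using u gint by (auto simp: set_integrable_def U_def G_def)
  have [measurable]: "U \<in> borel_measurable borel" "G \<in> borel_measurable borel"
    using U_int G_int by (auto dest: borel_measurable_integrable)
  have "closed {x :: real \<times> real. fst x \<le> snd x}"
    by (intro closed_Collect_le continuous_intros)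
  then have "{(s, t). (s::real) \<le> t} \<in> sets (borel \<Otimes>\<^sub>M borel)"
    unfolding borel_prod by (simp add: case_prod_unfold)
  then have [measurable]: "{(s, t). (s::real) \<le> t} \<in> sets (lborel \<Otimes>\<^sub>M lborel)"
    by (simp cong: sets_pair_measure_cong)
  have k_int: "integrable (lborel \<Otimes>\<^sub>M lborel) (case_prod k)"
  proof (rule Bochner_Integration.integrable_bound)
    \<comment> \<open>The kernel is dominated by a product of two integrable functions of separate
      variables.\<close>
    show "integrable (lborel \<Otimes>\<^sub>M lborel) (\<lambda>(s, t). U s * G t)"
    proof (rule lborel_pair.Fubini_integrable)
      show "integrable lborel (\<lambda>s. \<integral>t. norm (case (s, t) of (s, t) \<Rightarrow> U s * G t) \<partial>lborel)"
        using U_int by (simp add: abs_mult)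
      show "AE s in lborel. integrable lborel (\<lambda>t. case (s, t) of (s, t) \<Rightarrow> U s * G t)"
        using G_int by simp
    qed measurable
    show "AE x in lborel \<Otimes>\<^sub>M lborel. norm (case x of (s, t) \<Rightarrow> k s t) \<le> norm (case x of (s, t) \<Rightarrow> U s * G t)"
      by (auto simp: k_def indicator_def)
    show "case_prod k \<in> borel_measurable (lborel \<Otimes>\<^sub>M lborel)"
      unfolding k_def by measurable
  qed
  have "L2_inner T u v = (\<integral>s. U s * v s \<partial>lborel)"
    by (simp add: L2_inner_def set_lebesgue_integral_def U_def mult.assoc)
  also have "\<dots> = (\<integral>s. - (\<integral>t. k s t \<partial>lborel) \<partial>lborel)"
  proof (rule Bochner_Integration.integral_cong[OF refl])
    fix s
    show "U s * v s = - (\<integral>t. k s t \<partial>lborel)"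
    proof (cases "s \<in> {0<..<T}")
      case True
      have "(\<integral>t. k s t \<partial>lborel) = (\<integral>t. U s * (indicator {s..<T} t * g t) \<partial>lborel)"
        using True by (intro Bochner_Integration.integral_cong) (auto simp: k_def G_def indicator_def)
      also have "\<dots> = U s * (LINT t:{s..<T}|lborel. g t)"
        by (simp add: set_lebesgue_integral_def)
      finally show ?thesis using weak_deriv_FTC_end0[OF v g] True by simp
    next
      case False
      then have "U s = 0" by (simp add: U_def)
      then show ?thesis by (simp add: k_def)
    qed
  qed
  also have "\<dots> = - (\<integral>t. (\<integral>s. k s t \<partial>lborel) \<partial>lborel)"
    by (simp add: lborel_pair.Fubini_integral[OF k_int])
  also have "(\<integral>t. (\<integral>s. k s t \<partial>lborel) \<partial>lborel) = (\<integral>t. (LINT s:{0..t}|lborel. u s) * G t \<partial>lborel)"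
  proof (rule Bochner_Integration.integral_cong[OF refl])
    fix t
    show "(\<integral>s. k s t \<partial>lborel) = (LINT s:{0..t}|lborel. u s) * G t"
    proof (cases "t \<in> {0<..<T}")
      case True
      have "(\<integral>s. k s t \<partial>lborel) = (\<integral>s. (indicator {0<..t} s * u s) * G t \<partial>lborel)"
        using True by (intro Bochner_Integration.integral_cong) (auto simp: k_def U_def indicator_def)
      also have "\<dots> = (LINT s:{0<..t}|lborel. u s) * G t"
        by (simp add: set_lebesgue_integral_def)
      also have "(LINT s:{0<..t}|lborel. u s) = (LINT s:{0..t}|lborel. u s)"
      proof (rule set_integral_cong_set)
        have *: "set_borel_measurable lborel {0<..t} u"
          using set_integrable_subset[OF u, of "{0<..t}"] True by (force simp: set_borel_measurable_def set_integrable_def dest: borel_measurable_integrable)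
        then show "set_borel_measurable lborel {0<..t} u" .
        \<comment> \<open>The hypothesis says nothing about \<open>u\<close> at 0; a function
          supported at that single point carries measurability over to the closed interval.\<close>
        have "(\<lambda>s. indicator {0<..t} s *\<^sub>R u s + indicator {0} s *\<^sub>R u 0) \<in> borel_measurable lborel"
          using * unfolding set_borel_measurable_def by measurable
        also have "(\<lambda>s. indicator {0<..t} s *\<^sub>R u s + indicator {0} s *\<^sub>R u 0) = (\<lambda>s. indicator {0..t} s *\<^sub>R u s)"
          using True by (auto simp: indicator_def)
        finally show "set_borel_measurable lborel {0..t} u"
          unfolding set_borel_measurable_def .
        show "AE x in lborel. (x \<in> {0..t}) = (x \<in> {0<..t})"
          using AE_lborel_singleton[of 0] by eventually_elim auto
      qed
      finally show ?thesis .
    next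
      case False
      then have "G t = 0" by (simp add: G_def)
      then show ?thesis by (simp add: k_def)
    qed
  qed
  also have "\<dots> = L2_inner T (\<lambda>t. LINT s:{0..t}|lborel. u s) g"
    by (simp add: L2_inner_def set_lebesgue_integral_def G_def mult_ac)
  finally show ?thesis .
qed

section \<open>Cauchy-Schwarz for the boundary inner product\<close>

lemma nonneg_quadratic_discriminant:
  fixes A B C :: real
  assumes "\<And>c. 0 \<le> A + 2 * c * B + c\<^sup>2 * C" and C: "0 \<le> C"
  shows "B\<^sup>2 \<le> A * C"
proof (cases "C = 0")
  case True
  have "B = 0"
  proof (rule ccontr)
    assume "B \<noteq> 0"
    \<comment> \<open>With C = 0 the polynomial is affine in c, and this c gives it the value
      -1.\<close>
    then show False using assms(1)[of "- (A + 1) / (2 * B)"] True by (simp add: field_simps)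
  qed
  then show ?thesis using True by simp
next
  case False
  then have "0 < C" using C by simp
  \<comment> \<open>-B / C is the minimizer of the quadratic polynomial.\<close>
  then show ?thesis using assms(1)[of "- B / C"] by (simp add: field_simps power2_eq_square)
qed

lemma L2_inner_self_nonneg: "0 \<le> L2_inner T f f"
  unfolding L2_inner_def set_lebesgue_integral_def
  by (rule Bochner_Integration.integral_nonneg) (simp add: zero_le_mult_iff indicator_def)

lemma L2_inner_quadratic_nonneg:
  assumes "f \<in> L2 T" "g \<in> L2 T"
  shows "0 \<le> L2_inner T f f + 2 * c * L2_inner T f g + c\<^sup>2 * L2_inner T g g"
proof -
  let ?S = "set_integrable lborel {0<..<T}"
  have int: "?S (\<lambda>t. f t * f t)" "?S (\<lambda>t. f t * g t)" "?S (\<lambda>t. g t * g t)"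
    using assms by (auto intro: L2_mult_set_integrable)
  have "0 \<le> L2_inner T (\<lambda>t. f t + c * g t) (\<lambda>t. f t + c * g t)" by (rule L2_inner_self_nonneg)
  also have "\<dots> = (LINT t:{0<..<T}|lborel. (f t * f t + (2 * c) * (f t * g t)) + c\<^sup>2 * (g t * g t))"
    unfolding L2_inner_def by (intro arg_cong[where f = "set_lebesgue_integral lborel _"])
      (auto simp: algebra_simps power2_eq_square)
  also have "\<dots> = L2_inner T f f + 2 * c * L2_inner T f g + c\<^sup>2 * L2_inner T g g"
    using int by (simp add: L2_inner_def)
  finally show ?thesis .
qed

lemma Sigma_inner_self_nonneg: "0 \<le> Sigma_inner T u u"
  by (simp add: Sigma_inner_def L2_inner_self_nonneg)

lemma Sigma_inner_Cauchy_Schwarz: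
  assumes "u \<in> L2 T \<times> L2 T" "v \<in> L2 T \<times> L2 T"
  shows "(Sigma_inner T u v)\<^sup>2 \<le> Sigma_inner T u u * Sigma_inner T v v"
proof (rule nonneg_quadratic_discriminant)
  fix c
  show "0 \<le> Sigma_inner T u u + 2 * c * Sigma_inner T u v + c\<^sup>2 * Sigma_inner T v v"
    using L2_inner_quadratic_nonneg[of "fst u" T "fst v" c] L2_inner_quadratic_nonneg[of "snd u" T "snd v" c] assms
    by (auto simp: Sigma_inner_def algebra_simps)
qed (rule Sigma_inner_self_nonneg)

lemma L2_inner_continuous:
  assumes "continuous_on {0..T} f" "continuous_on {0..T} g"
  shows "L2_inner T f g = integral {0..T} (\<lambda>t. f t * g t)"
  using set_borel_integral_eq_integral(2)[OF L2_mult_set_integrable[OF assms[THEN continuous_on_imp_L2]]]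
  by (simp add: L2_inner_def integral_open_interval_real)

text \<open>The function T - t serves as a concrete nonzero element of the space, so that the
  supremum in \<open>dual_norm\<close> ranges over a nonempty set. The weak identity holds because
  (T - t) \<phi>(t) vanishes at both ends.\<close>

lemma has_weak_deriv_linear: "T > 0 \<Longrightarrow> has_weak_deriv T (\<lambda>t. T - t) (\<lambda>_. - 1)"
  unfolding has_weak_deriv_def
proof (intro conjI allI impI)
  assume T: "T > 0"
  fix \<phi> \<phi>' assume "test_function T \<phi> \<phi>'"
  then have deriv: "\<And>t. (\<phi> has_real_derivative \<phi>' t) (at t)" and cont': "continuous_on UNIV \<phi>'"
    and zero: "\<phi> 0 = 0"
    by (auto simp: test_function_def)
  have cont: "continuous_on A \<phi>" for A
    using deriv by (intro continuous_at_imp_continuous_on) (auto intro: DERIV_isCont)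
  have "((\<lambda>t. (T - t) * \<phi>' t - \<phi> t) has_integral (T - T) * \<phi> T - (T - 0) * \<phi> 0) {0..T}"
    using T deriv by (intro fundamental_theorem_of_calculus)
      (auto intro!: derivative_eq_intros has_field_derivative_at_within[OF deriv]
        simp: has_real_derivative_iff_has_vector_derivative[symmetric])
  then have "integral {0..T} (\<lambda>t. (T - t) * \<phi>' t - \<phi> t) = 0"
    using zero by (simp add: integral_unique)
  moreover have "integral {0..T} (\<lambda>t. (T - t) * \<phi>' t - \<phi> t)
      = integral {0..T} (\<lambda>t. (T - t) * \<phi>' t) - integral {0..T} \<phi>"
    by (intro integral_diff integrable_continuous_real continuous_intros cont continuous_on_subset[OF cont'] subset_UNIV)
  moreover have "L2_inner T (\<lambda>t. T - t) \<phi>' = integral {0..T} (\<lambda>t. (T - t) * \<phi>' t)"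
    by (intro L2_inner_continuous continuous_intros continuous_on_subset[OF cont'] subset_UNIV)
  moreover have "L2_inner T (\<lambda>_. - 1) \<phi> = integral {0..T} (\<lambda>t. - 1 * \<phi> t)"
    by (intro L2_inner_continuous continuous_intros cont)
  ultimately show "L2_inner T (\<lambda>t. T - t) \<phi>' = - L2_inner T (\<lambda>_. - 1) \<phi>" by simp
qed (intro continuous_on_imp_L2 continuous_intros)

lemma linear_in_H1_end0: "T > 0 \<Longrightarrow> (\<lambda>t. T - t) \<in> H1_end0 T"
  using has_weak_deriv_linear[of T]
  by (auto simp: H1_end0_def H1_def intro!: continuous_on_imp_L2 continuous_intros)

lemma H1_has_weak_deriv: "v \<in> H1 T \<Longrightarrow> has_weak_deriv T v (weak_deriv T v)"
  using someI[where P = "has_weak_deriv T v"] unfolding H1_def weak_deriv_def by blast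

text \<open>Integration by parts moves the derivative off v, and Cauchy-Schwarz against the weak
  derivatives cancels the norm of v. As the supremum gets squared, it must be bounded from below
  too: the quotients are bounded in absolute value, and one explicit member of the index set yields
  the bound -B.\<close>

lemma dual_norm_le_primitive:
  fixes u0 uL :: "real \<Rightarrow> real"
  assumes T: "T > 0"
    and u: "set_integrable lborel {0<..<T} u0" "set_integrable lborel {0<..<T} uL"
    and U: "U = (\<lambda>t. LINT s:{0..t}|lborel. u0 s, \<lambda>t. LINT s:{0..t}|lborel. uL s)"
    and UL2: "U \<in> L2 T \<times> L2 T"
  shows "(dual_norm T (Sigma_inner T (u0, uL)))\<^sup>2 \<le> Sigma_inner T U U"
proof -
  define B where "B = sqrt (Sigma_inner T U U)"
  define X where "X = {v \<in> H1_Sigma T. \<exists>t\<in>{0..T}. fst v t \<noteq> 0 \<or> snd v t \<noteq> 0}"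
  define q where "q = (\<lambda>v. Sigma_inner T (u0, uL) v / H1_Sigma_norm T v)"
  have B0: "0 \<le> B" by (simp add: B_def Sigma_inner_self_nonneg)
  have bound: "\<bar>q v\<bar> \<le> B" if "v \<in> X" for v
  proof -
    define g where "g = (weak_deriv T (fst v), weak_deriv T (snd v))"
    have v: "continuous_on {0..T} (fst v)" "fst v T = 0" "has_weak_deriv T (fst v) (fst g)"
      "continuous_on {0..T} (snd v)" "snd v T = 0" "has_weak_deriv T (snd v) (snd g)"
      using that by (auto simp: X_def H1_Sigma_def H1_end0_def g_def intro: H1_has_weak_deriv)
    have gL2: "g \<in> L2 T \<times> L2 T" using v(3,6) by (cases g) (auto simp: has_weak_deriv_def)
    have N: "H1_Sigma_norm T v = sqrt (Sigma_inner T g g)"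
      by (simp add: H1_Sigma_norm_def Sigma_inner_def g_def)
    have "Sigma_inner T (u0, uL) v = - Sigma_inner T U g"
      using L2_inner_weak_deriv_by_parts[OF v(1-3) u(1)] L2_inner_weak_deriv_by_parts[OF v(4-6) u(2)]
      by (simp add: Sigma_inner_def U)
    then have "(Sigma_inner T (u0, uL) v)\<^sup>2 \<le> Sigma_inner T U U * Sigma_inner T g g"
      using Sigma_inner_Cauchy_Schwarz[OF UL2 gL2] by simp
    then have "\<bar>Sigma_inner T (u0, uL) v\<bar> \<le> B * H1_Sigma_norm T v"
      unfolding N B_def real_sqrt_mult[symmetric] by (metis real_sqrt_abs real_sqrt_le_iff)
    moreover have "0 \<le> H1_Sigma_norm T v" by (simp add: N Sigma_inner_self_nonneg)
    \<comment> \<open>If the norm vanishes, the quotient is 0 by the convention for division, and 0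
      <= B covers this case.\<close>
    ultimately show ?thesis
      using B0 by (cases "H1_Sigma_norm T v = 0") (auto simp: q_def field_simps)
  qed
  have "(\<lambda>t. T - t, \<lambda>t. T - t) \<in> X"
    using linear_in_H1_end0[OF T] T by (auto simp: X_def H1_Sigma_def intro!: bexI[of _ 0])
  then have ne: "X \<noteq> {}" and x: "(\<lambda>t. T - t, \<lambda>t. T - t) \<in> X" by auto
  have "bdd_above (q ` X)" using bound by (intro bdd_aboveI[of _ B]) (auto simp: abs_le_iff)
  then have "- B \<le> (SUP v\<in>X. q v)"
    by (rule cSUP_upper2[OF _ x]) (use bound[OF x] in \<open>auto simp: abs_le_iff\<close>)
  moreover have "(SUP v\<in>X. q v) \<le> B"
    by (rule cSUP_least[OF ne]) (use bound in \<open>auto simp: abs_le_iff\<close>)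
  ultimately have "\<bar>dual_norm T (Sigma_inner T (u0, uL))\<bar> \<le> B"
    by (simp add: dual_norm_def X_def q_def abs_le_iff)
  then have "(dual_norm T (Sigma_inner T (u0, uL)))\<^sup>2 \<le> B\<^sup>2"
    using B0 by (simp add: abs_le_square_iff[symmetric])
  then show ?thesis by (simp add: B_def Sigma_inner_self_nonneg)
qed

section \<open>Uniform grids and meshes\<close>

lemma integral_affine:
  fixes \<alpha> \<beta> :: real
  assumes "a \<le> b" "\<And>t. t \<in> {a..b} \<Longrightarrow> f t = \<alpha> + \<beta> * t"
  shows "integral {a..b} f = (b - a) * (\<alpha> + \<beta> * ((a + b) / 2))"
proof -
  have "((\<lambda>t. \<alpha> + \<beta> * t) has_integral (\<alpha> * b + \<beta> * b\<^sup>2 / 2) - (\<alpha> * a + \<beta> * a\<^sup>2 / 2)) {a..b}"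
    by (rule fundamental_theorem_of_calculus[OF assms(1)])
      (auto intro!: derivative_eq_intros simp: has_real_derivative_iff_has_vector_derivative[symmetric])
  then have "(f has_integral (\<alpha> * b + \<beta> * b\<^sup>2 / 2) - (\<alpha> * a + \<beta> * a\<^sup>2 / 2)) {a..b}"
    by (rule has_integral_eq[rotated]) (use assms(2) in simp)
  then show ?thesis by (simp add: integral_unique field_simps power2_eq_square)
qed

lemma integral_affine_square:
  fixes \<alpha> \<beta> :: real
  assumes "a \<le> b" "\<And>t. t \<in> {a..b} \<Longrightarrow> f t = \<alpha> + \<beta> * t"
  shows "integral {a..b} (\<lambda>t. (f t)\<^sup>2) =
    (\<alpha>\<^sup>2 * b + \<alpha> * \<beta> * b\<^sup>2 + \<beta>\<^sup>2 * b ^ 3 / 3) - (\<alpha>\<^sup>2 * a + \<alpha> * \<beta> * a\<^sup>2 + \<beta>\<^sup>2 * a ^ 3 / 3)"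
proof -
  have "((\<lambda>t. (\<alpha> + \<beta> * t)\<^sup>2) has_integral
    (\<alpha>\<^sup>2 * b + \<alpha> * \<beta> * b\<^sup>2 + \<beta>\<^sup>2 * b ^ 3 / 3) - (\<alpha>\<^sup>2 * a + \<alpha> * \<beta> * a\<^sup>2 + \<beta>\<^sup>2 * a ^ 3 / 3)) {a..b}"
    by (rule fundamental_theorem_of_calculus[OF assms(1)])
      (auto intro!: derivative_eq_intros
        simp: has_real_derivative_iff_has_vector_derivative[symmetric] power2_eq_square algebra_simps)
  then have "((\<lambda>t. (f t)\<^sup>2) has_integral
    (\<alpha>\<^sup>2 * b + \<alpha> * \<beta> * b\<^sup>2 + \<beta>\<^sup>2 * b ^ 3 / 3) - (\<alpha>\<^sup>2 * a + \<alpha> * \<beta> * a\<^sup>2 + \<beta>\<^sup>2 * a ^ 3 / 3)) {a..b}"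
    by (rule has_integral_eq[rotated]) (use assms(2) in simp)
  then show ?thesis by (rule integral_unique)
qed

text \<open>For an affine function only the slope contributes to the projection error: it is
  \<open>\<beta>\<^sup>2 h\<^sup>3 / 12\<close> on each cell of length \<open>h\<close>, and \<open>\<beta>\<^sup>2 (m h)\<^sup>3 / 12\<close> is a lower bound for the full integral.\<close>

lemma affine_cell_averages:
  fixes \<alpha> \<beta> :: real
  assumes ab: "a < b" and f: "\<And>t. t \<in> {a..b} \<Longrightarrow> f t = \<alpha> + \<beta> * t" and m: "m > 0"
    and h: "h = (b - a) / real m"
  shows "(1 - 1 / (real m)\<^sup>2) * integral {a..b} (\<lambda>t. (f t)\<^sup>2)
     \<le> (\<Sum>r<m. (integral {a + real r * h..a + real (Suc r) * h} f)\<^sup>2 / h)"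
proof -
  have h0: "h > 0" using ab m by (simp add: h)
  have mh: "real m * h = b - a" using m by (simp add: h)
  define F where "F = (\<lambda>t. \<alpha>\<^sup>2 * t + \<alpha> * \<beta> * t\<^sup>2 + \<beta>\<^sup>2 * t ^ 3 / 3)"
  have I: "integral {a..b} (\<lambda>t. (f t)\<^sup>2) = F b - F a"
    using integral_affine_square[OF less_imp_le[OF ab] f] by (simp add: F_def)
  have cell: "(integral {a + real r * h..a + real (Suc r) * h} f)\<^sup>2 / h
      = F (a + real (Suc r) * h) - F (a + real r * h) - \<beta>\<^sup>2 * h ^ 3 / 12" if r: "r < m" for r
  proof -
    define p where "p = a + real r * h"
    have q: "a + real (Suc r) * h = p + h" by (simp add: p_def algebra_simps)
    have "real (Suc r) * h \<le> real m * h" using r h0 by (intro mult_right_mono) auto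
    then have "a \<le> p" "p + h \<le> b" using h0 mh q by (simp_all add: p_def)
    then have "integral {p..p + h} f = (p + h - p) * (\<alpha> + \<beta> * ((p + (p + h)) / 2))"
      using f h0 by (intro integral_affine) auto
    also have "\<dots> = h * (\<alpha> + \<beta> * (p + h / 2))" by (simp add: field_simps)
    finally have "(integral {p..p + h} f)\<^sup>2 / h = h * (\<alpha> + \<beta> * (p + h / 2))\<^sup>2"
      using h0 by (simp add: power2_eq_square)
    also have "\<dots> = F (p + h) - F p - \<beta>\<^sup>2 * h ^ 3 / 12"
      by (simp add: F_def power2_eq_square power3_eq_cube field_simps)
    finally show ?thesis unfolding q p_def[symmetric] .
  qed
  have "(\<Sum>r<m. (integral {a + real r * h..a + real (Suc r) * h} f)\<^sup>2 / h)
      = (\<Sum>r<m. F (a + real (Suc r) * h) - F (a + real r * h) - \<beta>\<^sup>2 * h ^ 3 / 12)"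
    by (rule sum.cong[OF refl], rule cell) simp
  also have "\<dots> = (\<Sum>r<m. F (a + real (Suc r) * h) - F (a + real r * h)) - real m * (\<beta>\<^sup>2 * h ^ 3 / 12)"
    by (simp only: sum_subtractf sum_constant card_lessThan)
  also have "(\<Sum>r<m. F (a + real (Suc r) * h) - F (a + real r * h)) = F b - F a"
    using sum_lessThan_telescope[of "\<lambda>r. F (a + real r * h)" m] mh by simp
  finally have S: "(\<Sum>r<m. (integral {a + real r * h..a + real (Suc r) * h} f)\<^sup>2 / h)
      = F b - F a - real m * (\<beta>\<^sup>2 * h ^ 3 / 12)" .
  \<comment> \<open>Squared mean plus variance: the deviation from the midpoint value contributes
    \<beta>^2 (b - a)^3 / 12.\<close>
  have "F b - F a = (b - a) * (\<alpha> + \<beta> * ((a + b) / 2))\<^sup>2 + \<beta>\<^sup>2 * (b - a) ^ 3 / 12"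
    by (simp add: F_def power2_eq_square power3_eq_cube field_simps)
  then have "\<beta>\<^sup>2 * (b - a) ^ 3 / 12 \<le> F b - F a" using ab by simp
  then have "\<beta>\<^sup>2 * (real m * h) ^ 3 / 12 / (real m)\<^sup>2 \<le> (F b - F a) / (real m)\<^sup>2"
    unfolding mh by (rule divide_right_mono) simp
  \<comment> \<open>Since b - a = m h, the errors of the m cells add up to 1/m^2 times the slope
    part of the full integral.\<close>
  moreover have "\<beta>\<^sup>2 * (real m * h) ^ 3 / 12 / (real m)\<^sup>2 = real m * (\<beta>\<^sup>2 * h ^ 3 / 12)"
    using m by (simp add: power2_eq_square power3_eq_cube)
  ultimately have "real m * (\<beta>\<^sup>2 * h ^ 3 / 12) \<le> (F b - F a) / (real m)\<^sup>2" by (simp only:)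
  moreover have "(1 - 1 / (real m)\<^sup>2) * (F b - F a) = F b - F a - (F b - F a) / (real m)\<^sup>2"
    by (simp add: left_diff_distrib)
  ultimately show ?thesis unfolding S I by linarith
qed

section \<open>Elements of a uniform mesh as cells of a grid\<close>

lemma mesh_subset:
  assumes "mesh T \<tau>"
  shows "{lo (\<tau> i)..hi (\<tau> i)} \<subseteq> {0..T}"
proof -
  have "{lo (\<tau> i)..hi (\<tau> i)} \<subseteq> (\<Union>j\<in>{j. elem_side (\<tau> j) = elem_side (\<tau> i)}. {lo (\<tau> j)..hi (\<tau> j)})"
    by blast
  also have "\<dots> = {0..T}" using assms by (simp add: mesh_def)
  finally show ?thesis .
qed

text \<open>A mesh is an unordered family, so positions must be recovered from covering and
  disjointness. An element that does not start at 0 has a left neighbour ending exactly where it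
  starts; stepping back by d is the induction, on a bound k for the left end in units of d.\<close>

lemma uniform_mesh_lo_multiple:
  assumes mesh: "mesh T \<tau>" and d: "\<And>i. hi (\<tau> i) - lo (\<tau> i) = d"
  shows "\<exists>p::nat. lo (\<tau> i) = real p * d"
proof -
  have pos: "lo (\<tau> i) < hi (\<tau> i)" for i using mesh by (auto simp: mesh_def)
  have d0: "d > 0" using pos[of i] d[of i] by simp
  have sub: "{lo (\<tau> i)..hi (\<tau> i)} \<subseteq> {0..T}" for i
    by (rule mesh_subset[OF mesh])
  have "lo (\<tau> i) < real k * d \<Longrightarrow> \<exists>p::nat. lo (\<tau> i) = real p * d" for k :: nat and i
  proof (induction k arbitrary: i)
    case 0
    then show ?case using sub[of i] pos[of i] by (auto simp: subset_iff)
  next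
    case (Suc k)
    define x where "x = lo (\<tau> i)"
    have x0: "0 \<le> x" "x \<le> T" using sub[of i] pos[of i] by (auto simp: x_def)
    show ?case
    proof (cases "x = 0")
      case True
      then show ?thesis by (auto simp: x_def intro!: exI[of _ 0])
    next
      case False
      \<comment> \<open>The right ends before x, together with 0. No element ends strictly between
        \<open>Max H\<close> and x, so an element covering the midpoint y reaches at least to
        x.\<close>
      define H where "H = insert 0 {h \<in> range (\<lambda>j. hi (\<tau> j)). h < x}"
      have H: "finite H" "H \<noteq> {}" by (auto simp: H_def)
      have M: "Max H < x" using Max_in[OF H] x0 False by (auto simp: H_def)
      have M0: "0 \<le> Max H" using H by (simp add: H_def)
      define y where "y = (Max H + x) / 2"
      have y: "Max H < y" "y < x" "y \<in> {0..T}" using M M0 x0 by (auto simp: y_def)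
      have "y \<in> (\<Union>j\<in>{j. elem_side (\<tau> j) = elem_side (\<tau> i)}. {lo (\<tau> j)..hi (\<tau> j)})"
        using mesh y(3) unfolding mesh_def by blast
      then obtain j where j: "elem_side (\<tau> j) = elem_side (\<tau> i)" "lo (\<tau> j) \<le> y" "y \<le> hi (\<tau> j)"
        by auto
      have "x \<le> hi (\<tau> j)"
      proof (rule ccontr)
        assume "\<not> x \<le> hi (\<tau> j)"
        then have "hi (\<tau> j) \<in> H" by (auto simp: H_def)
        then show False using Max_ge[OF H(1), of "hi (\<tau> j)"] y j by simp
      qed
      moreover have "hi (\<tau> j) \<le> x"
      proof (rule ccontr)
        assume *: "\<not> hi (\<tau> j) \<le> x"
        \<comment> \<open>If the neighbour extended beyond x, z would be interior to both elements,
          against disjointness.\<close>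
        define z where "z = (x + min (hi (\<tau> j)) (hi (\<tau> i))) / 2"
        have "i \<noteq> j" using j y by (auto simp: x_def)
        then have "{lo (\<tau> i)<..<hi (\<tau> i)} \<inter> {lo (\<tau> j)<..<hi (\<tau> j)} = {}"
          using mesh j by (simp add: mesh_def)
        moreover have "x < z" "z < hi (\<tau> i)" "z < hi (\<tau> j)"
          using * pos[of i] by (auto simp: z_def x_def min_def)
        then have "z \<in> {lo (\<tau> i)<..<hi (\<tau> i)} \<inter> {lo (\<tau> j)<..<hi (\<tau> j)}"
          using j y by (auto simp: x_def)
        ultimately show False by blast
      qed
      ultimately have eq: "x = lo (\<tau> j) + d" using d[of j] by simp
      then have "lo (\<tau> j) < real k * d" using Suc.prems by (simp add: x_def algebra_simps)
      then obtain p :: nat where "lo (\<tau> j) = real p * d" using Suc.IH by blast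
      then have "lo (\<tau> i) = real (Suc p) * d" using eq by (simp add: x_def algebra_simps)
      then show ?thesis by blast
    qed
  qed
  moreover obtain k :: nat where "lo (\<tau> i) < real k * d"
    using reals_Archimedean3[OF d0] by blast
  ultimately show ?thesis by blast
qed

section \<open>Functions that are affine on each cell of a grid\<close>

definition ramp :: "real \<Rightarrow> real \<Rightarrow> real \<Rightarrow> real" where
  "ramp a b t = max 0 (min t b - a)"

lemma continuous_on_ramp [continuous_intros]:
  "continuous_on A f \<Longrightarrow> continuous_on A (\<lambda>t. ramp a b (f t))"
  unfolding ramp_def by (intro continuous_intros)

lemma ramp_nonpos: "0 \<le> a \<Longrightarrow> t \<le> 0 \<Longrightarrow> ramp a b t = 0"
  by (simp add: ramp_def)

text \<open>For t < 0 the range of integration is empty, in agreement with the \<open>max 0\<close>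
  in \<open>ramp\<close>; delayed arguments t - L therefore need no case distinction.\<close>

lemma integral_indicator_eq_ramp:
  assumes "0 \<le> a" "a < b"
  shows "(LINT s:{0..t}|lborel. indicator {a<..<b} s) = ramp a b t"
proof -
  have "(LINT s:{0..t}|lborel. indicator {a<..<b} s) = measure lborel ({0..t} \<inter> {a<..<b})"
    by (simp add: set_lebesgue_integral_def indicator_inter_arith[symmetric])
  also have "{0..t} \<inter> {a<..<b} = (if b \<le> t then {a<..<b} else {a<..t})"
    using assms by auto
  also have "measure lborel \<dots> = ramp a b t"
    using assms by (auto simp: ramp_def min_def max_def)
  finally show ?thesis .
qed

text \<open>Cells are indexed by integers, so negative times are included and a delay by a multiple
  of d maps the grid onto itself. This is what makes the delayed term of V affine on the same
  cells.\<close>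

definition grid_affine :: "real \<Rightarrow> (real \<Rightarrow> real) \<Rightarrow> bool" where
  "grid_affine d f \<longleftrightarrow>
     (\<forall>k::int. \<exists>\<alpha> \<beta>. \<forall>t\<in>{of_int k * d..of_int (k + 1) * d}. f t = \<alpha> + \<beta> * t)"

lemma grid_affine_ramp:
  assumes "d > 0"
  shows "grid_affine d (ramp (of_int p * d) (of_int (p + 1) * d))"
  unfolding grid_affine_def
proof
  fix k :: int
  consider "k < p" | "k = p" | "p < k" by linarith
  then show "\<exists>\<alpha> \<beta>. \<forall>t\<in>{of_int k * d..of_int (k + 1) * d}. ramp (of_int p * d) (of_int (p + 1) * d) t = \<alpha> + \<beta> * t"
  proof cases
    case 1
    then have "of_int (k + 1) * d \<le> of_int p * d" using assms by (intro mult_right_mono) auto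
    then show ?thesis by (intro exI[of _ 0]) (auto simp: ramp_def)
  next
    case 2
    then show ?thesis by (intro exI[of _ "- of_int p * d"] exI[of _ 1]) (auto simp: ramp_def)
  next
    case 3
    then have "of_int (p + 1) * d \<le> of_int k * d" using assms by (intro mult_right_mono) auto
    then show ?thesis using assms
      by (intro exI[of _ d] exI[of _ 0]) (auto simp: ramp_def min_def algebra_simps)
  qed
qed

lemma grid_affine_const_0: "grid_affine d (\<lambda>_. 0)"
  unfolding grid_affine_def by (intro allI exI[of _ 0]) simp

lemma grid_affine_add:
  assumes "grid_affine d f" "grid_affine d g"
  shows "grid_affine d (\<lambda>t. f t + g t)"
  unfolding grid_affine_def
proof
  fix k :: int
  obtain \<alpha> \<beta> \<alpha>' \<beta>' where "\<forall>t\<in>{of_int k * d..of_int (k + 1) * d}. f t = \<alpha> + \<beta> * t"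
    "\<forall>t\<in>{of_int k * d..of_int (k + 1) * d}. g t = \<alpha>' + \<beta>' * t"
    using assms unfolding grid_affine_def by meson
  then show "\<exists>\<alpha> \<beta>. \<forall>t\<in>{of_int k * d..of_int (k + 1) * d}. f t + g t = \<alpha> + \<beta> * t"
    by (intro exI[of _ "\<alpha> + \<alpha>'"] exI[of _ "\<beta> + \<beta>'"]) (auto simp: algebra_simps)
qed

lemma grid_affine_cmult:
  assumes "grid_affine d f"
  shows "grid_affine d (\<lambda>t. c * f t)"
  unfolding grid_affine_def
proof
  fix k :: int
  obtain \<alpha> \<beta> where "\<forall>t\<in>{of_int k * d..of_int (k + 1) * d}. f t = \<alpha> + \<beta> * t"
    using assms unfolding grid_affine_def by meson
  then show "\<exists>\<alpha> \<beta>. \<forall>t\<in>{of_int k * d..of_int (k + 1) * d}. c * f t = \<alpha> + \<beta> * t"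
    by (intro exI[of _ "c * \<alpha>"] exI[of _ "c * \<beta>"]) (auto simp: algebra_simps)
qed

lemma grid_affine_sum:
  assumes "\<And>i. i \<in> A \<Longrightarrow> grid_affine d (f i)"
  shows "grid_affine d (\<lambda>t. \<Sum>i\<in>A. f i t)"
  using assms
  by (induction A rule: infinite_finite_induct) (auto intro: grid_affine_add grid_affine_const_0)

lemma grid_affine_shift:
  assumes "grid_affine d f"
  shows "grid_affine d (\<lambda>t. f (t - of_int l * d))"
  unfolding grid_affine_def
proof
  fix k :: int
  obtain \<alpha> \<beta> where *: "\<forall>t\<in>{of_int (k - l) * d..of_int (k - l + 1) * d}. f t = \<alpha> + \<beta> * t"
    using assms unfolding grid_affine_def by meson
  show "\<exists>\<alpha> \<beta>. \<forall>t\<in>{of_int k * d..of_int (k + 1) * d}. f (t - of_int l * d) = \<alpha> + \<beta> * t"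
  proof (intro exI ballI)
    fix t assume "t \<in> {of_int k * d..of_int (k + 1) * d}"
    then have "t - of_int l * d \<in> {of_int (k - l) * d..of_int (k - l + 1) * d}"
      by (simp add: algebra_simps)
    then show "f (t - of_int l * d) = (\<alpha> - \<beta> * (of_int l * d)) + \<beta> * t"
      using * by (simp add: algebra_simps)
  qed
qed

section \<open>Splitting the time interval into slices of length L\<close>

lemma integral_slices:
  fixes F :: "real \<Rightarrow> real"
  assumes "continuous_on UNIV F" "0 \<le> L"
  shows "integral {0..real n * L} F = integral {0..L} (\<lambda>t. \<Sum>j=1..n. F (t + (real j - 1) * L))"
proof (induction n)
  case (Suc n)
  have cont: "continuous_on A (\<lambda>t. F (f t))" if "continuous_on A f" for A and f :: "real \<Rightarrow> real"
    using continuous_on_compose2[OF assms(1) that] by simp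
  have "integral {0..real (Suc n) * L} F = integral {0..real n * L} F + integral {real n * L..real (Suc n) * L} F"
    using assms by (intro Henstock_Kurzweil_Integration.integral_combine[symmetric] integrable_continuous_real)
      (auto intro: continuous_on_subset mult_right_mono)
  also have "integral {real n * L..real (Suc n) * L} F = integral {0..L} (\<lambda>t. F (t + real n * L))"
    using integral_shift_real_ivl[of "real n * L" "real n * L" "real (Suc n) * L" F]
    by (simp add: algebra_simps)
  also have "integral {0..real n * L} F + integral {0..L} (\<lambda>t. F (t + real n * L))
      = integral {0..L} (\<lambda>t. (\<Sum>j=1..n. F (t + (real j - 1) * L)) + F (t + real n * L))"
    unfolding Suc.IH
    by (intro integral_add[symmetric] integrable_continuous_real continuous_intros cont)
  finally show ?case by simp
qed simp

text \<open>For fixed t in [0,L] the samples in the n slices satisfy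
  \<open>coupled_wirtinger\<close>, because a delay by L lowers the slice index by one. The halves
  contribute 1/4 and cancel the factor 4.\<close>

lemma square_integral_slices_ge:
  fixes p q :: "real \<Rightarrow> real"
  assumes L: "L > 0" and cont: "continuous_on UNIV p" "continuous_on UNIV q"
    and zero: "\<And>t. t \<le> 0 \<Longrightarrow> p t = 0" "\<And>t. t \<le> 0 \<Longrightarrow> q t = 0"
  shows "(sin (pi / (2 * (2 * real n + 1))))\<^sup>2 * integral {0..real n * L} (\<lambda>t. (p t)\<^sup>2 + (q t)\<^sup>2)
    \<le> integral {0..real n * L} (\<lambda>t. (p t / 2 + q (t - L) / 2)\<^sup>2 + (q t / 2 + p (t - L) / 2)\<^sup>2)"
proof -
  define s where "s = (sin (pi / (2 * (2 * real n + 1))))\<^sup>2"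
  have c: "continuous_on A (\<lambda>t. p (f t))" "continuous_on A (\<lambda>t. q (f t))"
    if "continuous_on A f" for A and f :: "real \<Rightarrow> real"
    using cont[THEN continuous_on_compose2, OF that] by simp_all
  let ?Q = "\<lambda>t. (p t)\<^sup>2 + (q t)\<^sup>2"
  let ?F = "\<lambda>t. (p t / 2 + q (t - L) / 2)\<^sup>2 + (q t / 2 + p (t - L) / 2)\<^sup>2"
  have "s * integral {0..real n * L} ?Q = s * integral {0..L} (\<lambda>t. \<Sum>j=1..n. ?Q (t + (real j - 1) * L))"
    using L by (subst integral_slices) (auto intro!: continuous_intros c)
  also have "\<dots> = integral {0..L} (\<lambda>t. s * (\<Sum>j=1..n. ?Q (t + (real j - 1) * L)))"
    by simp
  also have "\<dots> \<le> integral {0..L} (\<lambda>t. \<Sum>j=1..n. ?F (t + (real j - 1) * L))"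
  proof (rule integral_le)
    fix t assume t: "t \<in> {0..L}"
    define x where "x = (\<lambda>j. p (t + (real j - 1) * L))"
    define y where "y = (\<lambda>j. q (t + (real j - 1) * L))"
    \<comment> \<open>Index 0 samples t - L <= 0, where p and q vanish. The subtraction in
      \<open>real j - 1\<close> is real, so j = 0 gives t - L and not t.\<close>
    have "4 * s * (\<Sum>j=1..n. (x j)\<^sup>2 + (y j)\<^sup>2) \<le> (\<Sum>j=1..n. (x j + y (j - 1))\<^sup>2 + (y j + x (j - 1))\<^sup>2)"
      unfolding s_def using t by (intro coupled_wirtinger) (simp_all add: x_def y_def zero)
    also have "\<dots> = (\<Sum>j=1..n. 4 * ?F (t + (real j - 1) * L))"
    proof (rule sum.cong[OF refl])
      fix j assume "j \<in> {1..n}"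
      then have "t + (real j - 1) * L - L = t + (real (j - 1) - 1) * L"
        by (simp add: of_nat_diff algebra_simps)
      then show "(x j + y (j - 1))\<^sup>2 + (y j + x (j - 1))\<^sup>2 = 4 * ?F (t + (real j - 1) * L)"
        by (simp only: x_def y_def) (simp add: power2_eq_square field_simps)
    qed
    also have "\<dots> = 4 * (\<Sum>j=1..n. ?F (t + (real j - 1) * L))" by (simp only: sum_distrib_left)
    finally show "s * (\<Sum>j=1..n. ?Q (t + (real j - 1) * L)) \<le> (\<Sum>j=1..n. ?F (t + (real j - 1) * L))"
      unfolding x_def y_def by linarith
  qed (auto intro!: integrable_continuous_real continuous_intros c)
  also have "\<dots> = integral {0..real n * L} ?F"
    using L by (subst integral_slices[where F = ?F]) (auto intro!: continuous_intros c)
  finally show ?thesis unfolding s_def .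
qed

text \<open>The closed elements of one side cover [0,T], so a nonnegative f is at most the sum of
  its restrictions. Nodes shared by two elements are counted twice, which the inequality
  tolerates.\<close>

lemma mesh_integral_le:
  fixes f :: "real \<Rightarrow> real"
  assumes mesh: "mesh T \<tau>" and cont: "continuous_on {0..T} f" and f: "\<And>t. 0 \<le> f t"
  shows "integral {0..T} f \<le> (\<Sum>i | elem_side (\<tau> i) = c. integral {lo (\<tau> i)..hi (\<tau> i)} f)"
proof -
  let ?g = "\<lambda>i t. if t \<in> {lo (\<tau> i)..hi (\<tau> i)} then f t else 0"
  have int: "?g i integrable_on {0..T}" and eq: "integral {0..T} (?g i) = integral {lo (\<tau> i)..hi (\<tau> i)} f" for i
  proof -
    have "f integrable_on {lo (\<tau> i)..hi (\<tau> i)}"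
      by (rule integrable_continuous_real[OF continuous_on_subset[OF cont mesh_subset[OF mesh]]])
    moreover have "{lo (\<tau> i)..hi (\<tau> i)} \<inter> {0..T} = {lo (\<tau> i)..hi (\<tau> i)}"
      using mesh_subset[OF mesh] by blast
    ultimately show "?g i integrable_on {0..T}"
      "integral {0..T} (?g i) = integral {lo (\<tau> i)..hi (\<tau> i)} f"
      using integrable_restrict_Int[of "{lo (\<tau> i)..hi (\<tau> i)}" f "{0..T}"]
        integral_restrict_Int[of "{0..T}" "{lo (\<tau> i)..hi (\<tau> i)}" f]
      by (simp_all add: Int_commute del: Int_atLeastAtMost)
  qed
  have "integral {0..T} f \<le> integral {0..T} (\<lambda>t. \<Sum>i | elem_side (\<tau> i) = c. ?g i t)"
  proof (rule integral_le)
    show "(\<lambda>t. \<Sum>i | elem_side (\<tau> i) = c. ?g i t) integrable_on {0..T}"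
      by (intro integrable_sum int) simp
    fix t assume "t \<in> {0..T}"
    then have "t \<in> (\<Union>i\<in>{i. elem_side (\<tau> i) = c}. {lo (\<tau> i)..hi (\<tau> i)})"
      using mesh unfolding mesh_def by blast
    then obtain i where "elem_side (\<tau> i) = c" "t \<in> {lo (\<tau> i)..hi (\<tau> i)}" by blast
    then show "f t \<le> (\<Sum>i | elem_side (\<tau> i) = c. ?g i t)"
      using member_le_sum[of i "{i. elem_side (\<tau> i) = c}" "\<lambda>i. ?g i t"] f by simp
  qed (intro integrable_continuous_real cont)
  also have "\<dots> = (\<Sum>i | elem_side (\<tau> i) = c. integral {0..T} (?g i))"
    by (rule integral_sum[OF finite int])
  finally show ?thesis by (simp only: eq)
qed

section \<open>Refined meshes\<close>

lemma subelem_simps [simp]: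
  "elem_side (subelem m e r) = elem_side e"
  "lo (subelem m e r) = lo e + real r * ((hi e - lo e) / real m)"
  "hi (subelem m e r) = lo e + real (Suc r) * ((hi e - lo e) / real m)"
  by (simp_all add: subelem_def)

lemma subelem_bounds:
  assumes "lo e < hi e" "r < m"
  shows "lo e \<le> lo (subelem m e r)" "lo (subelem m e r) < hi (subelem m e r)"
    "hi (subelem m e r) \<le> hi e"
proof -
  let ?h = "(hi e - lo e) / real m"
  have h: "?h > 0" using assms by simp
  have "0 \<le> real r * ?h" "real r * ?h < real (Suc r) * ?h"
    using h by (intro mult_nonneg_nonneg mult_strict_right_mono; simp)+
  then show "lo e \<le> lo (subelem m e r)" "lo (subelem m e r) < hi (subelem m e r)"
    by (simp_all only: subelem_simps add_less_cancel_left le_add_same_cancel1)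
  have "real (Suc r) * ?h \<le> real m * ?h" using assms h by (intro mult_right_mono) auto
  then show "hi (subelem m e r) \<le> hi e" using assms by simp
qed

lemma subelem_disjoint:
  assumes "lo e < hi e" "r < r'" "r' < m"
  shows "hi (subelem m e r) \<le> lo (subelem m e r')"
proof -
  have "real (Suc r) * ((hi e - lo e) / real m) \<le> real r' * ((hi e - lo e) / real m)"
    using assms by (intro mult_right_mono) auto
  then show ?thesis by simp
qed

lemma mesh_overlap_imp_eq:
  assumes "mesh T \<tau>" "elem_side (\<tau> i) = elem_side (\<tau> j)"
    "t \<in> {lo (\<tau> i)<..<hi (\<tau> i)}" "t \<in> {lo (\<tau> j)<..<hi (\<tau> j)}"
  shows "i = j"
  using assms unfolding mesh_def by blast

lemma subelem_overlap_imp_eq: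
  assumes mesh: "mesh T \<tau>" and r: "r < m" "r' < m" and side: "elem_side (\<tau> i) = elem_side (\<tau> j)"
    and t: "t \<in> {lo (subelem m (\<tau> i) r)<..<hi (subelem m (\<tau> i) r)}"
      "t \<in> {lo (subelem m (\<tau> j) r')<..<hi (subelem m (\<tau> j) r')}"
  shows "i = j \<and> r = r'"
proof -
  have pos: "lo (\<tau> i) < hi (\<tau> i)" for i using mesh by (auto simp: mesh_def)
  have "t \<in> {lo (\<tau> i)<..<hi (\<tau> i)}" "t \<in> {lo (\<tau> j)<..<hi (\<tau> j)}"
    using subelem_bounds[OF pos r(1), of i] subelem_bounds[OF pos r(2), of j] t
    by (auto simp del: subelem_simps)
  then have "i = j" using mesh_overlap_imp_eq[OF mesh side] by blast
  moreover have "r = r'"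
    using subelem_disjoint[OF pos _ r(1), of r' i] subelem_disjoint[OF pos _ r(2), of r i] t \<open>i = j\<close>
    by (cases r r' rule: linorder_cases) (auto simp del: subelem_simps)
  ultimately show ?thesis by simp
qed

text \<open>The fine index type is tied to the coarse one only through the set of elements.
  Reindexing by pairs (i, r) works because different pairs give subelements without common interior
  points, hence different elements.\<close>

lemma sum_equal_refinement:
  assumes mesh: "mesh T \<tau>" and ref: "equal_refinement m \<tau> \<tau>'"
  shows "(\<Sum>k\<in>UNIV. G (\<tau>' k)) = (\<Sum>i\<in>UNIV. \<Sum>r<m. G (subelem m (\<tau> i) r))"
proof -
  let ?s = "\<lambda>(i, r). subelem m (\<tau> i) r"
  have pos: "lo (\<tau> i) < hi (\<tau> i)" for i using mesh by (auto simp: mesh_def)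
  have inj: "inj_on ?s (UNIV \<times> {..<m})"
  proof (rule inj_onI, clarsimp simp del: subelem_simps)
    fix i r j r' assume *: "r < m" "r' < m" "subelem m (\<tau> i) r = subelem m (\<tau> j) r'"
    obtain t where t: "t \<in> {lo (subelem m (\<tau> i) r)<..<hi (subelem m (\<tau> i) r)}"
      using subelem_bounds(2)[OF pos *(1), of i] dense by (auto simp del: subelem_simps)
    have "elem_side (\<tau> i) = elem_side (\<tau> j)" using arg_cong[OF *(3), of elem_side] by simp
    then show "i = j \<and> r = r'"
      using subelem_overlap_imp_eq[OF mesh *(1,2) _ t] t unfolding *(3) by blast
  qed
  have "(\<Sum>k\<in>UNIV. G (\<tau>' k)) = sum G (range \<tau>')"
    by (rule sum.reindex_cong[OF _ refl refl, symmetric]) (use ref in \<open>simp add: equal_refinement_def\<close>)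
  also have "range \<tau>' = ?s ` (UNIV \<times> {..<m})"
    using ref by (auto simp: equal_refinement_def image_iff)
  also have "sum G \<dots> = (\<Sum>x\<in>UNIV \<times> {..<m}. G (?s x))"
    by (simp add: sum.reindex[OF inj])
  also have "\<dots> = (\<Sum>i\<in>UNIV. \<Sum>r<m. G (subelem m (\<tau> i) r))"
    by (simp add: sum.cartesian_product case_prod_unfold)
  finally show ?thesis .
qed

section \<open>The Schur complement\<close>

text \<open>Selecting the component by a \<open>side\<close> allows one statement for both ends; the
  symmetry of V then becomes an exchange of c and \<open>opposite c\<close>.\<close>

fun bcomp :: "side \<Rightarrow> bfun \<Rightarrow> real \<Rightarrow> real" where
  "bcomp At_0 u = fst u"
| "bcomp At_L u = snd u"

lemma bcomp_elem_fun:
  "bcomp c (elem_fun e) = (if elem_side e = c then indicator {lo e<..<hi e} else (\<lambda>_. 0))"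
  by (cases c) (auto simp: elem_fun_def)

lemma L2_inner_indicator:
  assumes "0 \<le> a" "b \<le> T"
  shows "L2_inner T f (indicator {a<..<b}) = (LINT t:{a<..<b}|lborel. f t)"
  unfolding L2_inner_def set_lebesgue_integral_def
  by (rule Bochner_Integration.integral_cong) (use assms in \<open>auto simp: indicator_def\<close>)

lemma Sigma_inner_elem_fun:
  assumes "0 \<le> lo e" "hi e \<le> T"
  shows "Sigma_inner T u (elem_fun e) = (LINT t:{lo e<..<hi e}|lborel. bcomp (elem_side e) u t)"
proof -
  have z: "L2_inner T f (\<lambda>_. 0) = 0" for f by (simp add: L2_inner_def)
  have "Sigma_inner T u (elem_fun e) = L2_inner T (bcomp At_0 u) (bcomp At_0 (elem_fun e))
      + L2_inner T (bcomp At_L u) (bcomp At_L (elem_fun e))"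
    by (simp add: Sigma_inner_def)
  then show ?thesis
    using assms by (cases "elem_side e") (simp_all add: bcomp_elem_fun z L2_inner_indicator del: bcomp.simps)
qed

text \<open>\<open>matrix_inv\<close> is a choice operator. The diagonal of reciprocals shows that D
  is invertible; after that y = \<open>matrix_inv D *v x\<close> is determined entrywise from D y =
  x.\<close>

lemma matrix_inv_diagonal_quadratic_form:
  fixes D :: "real^'k^'k" and x :: "real^'k"
  assumes D: "\<And>i j. D $ i $ j = (if i = j then h i else 0)" and h: "\<And>i. h i \<noteq> 0"
  shows "(matrix_inv D *v x) \<bullet> x = (\<Sum>i\<in>UNIV. (x $ i)\<^sup>2 / h i)"
proof -
  have "D ** (\<chi> i j. if i = j then 1 / h i else 0) = mat 1"
    "(\<chi> i j. if i = j then 1 / h i else 0) ** D = mat 1"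
    using h by (simp_all add: matrix_matrix_mult_def mat_def D vec_eq_iff if_distrib[of "\<lambda>x. x * _"]
        if_distrib[of "\<lambda>x. _ * x"] cong: if_cong)
  then have "invertible D" by (auto simp: invertible_def)
  then have "D ** matrix_inv D = mat 1"
    unfolding invertible_def matrix_inv_def by (rule someI2_ex) auto
  then have "D *v (matrix_inv D *v x) = x" by (simp add: matrix_vector_mul_assoc)
  then have "h i * (matrix_inv D *v x) $ i = x $ i" for i
    by (simp add: vec_eq_iff matrix_vector_mult_def D if_distrib[of "\<lambda>x. x * _"] cong: if_cong)
  then have "(matrix_inv D *v x) $ i = x $ i / h i" for i
    using h by (metis nonzero_mult_div_cancel_left)
  then show ?thesis by (simp add: inner_vec_def power2_eq_square)
qed

text \<open>The antiderivative P_0 or P_L in closed form. As a combination of ramps it is defined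
  and continuous on the whole line.\<close>

definition primitive :: "('i::finite \<Rightarrow> elem) \<Rightarrow> real^'i \<Rightarrow> side \<Rightarrow> real \<Rightarrow> real" where
  "primitive \<tau> w c t = (\<Sum>i | elem_side (\<tau> i) = c. w $ i * ramp (lo (\<tau> i)) (hi (\<tau> i)) t)"

fun opposite :: "side \<Rightarrow> side" where
  "opposite At_0 = At_L"
| "opposite At_L = At_0"

lemma sum_UNIV_by_side:
  fixes f :: "'i::finite \<Rightarrow> real"
  shows "(\<Sum>i\<in>UNIV. f i) = (\<Sum>i | s i = At_0. f i) + (\<Sum>i | s i = At_L. f i)"
proof -
  have "UNIV = {i. s i = At_0} \<union> {i. s i = At_L}" by (auto intro: side.exhaust)
  then show ?thesis by (metis (mono_tags, lifting) Collect_disj_eq disjoint_iff finite_code mem_Collect_eq side.distinct(1) sum.union_disjoint)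
qed

lemma continuous_on_primitive [continuous_intros]:
  "continuous_on A f \<Longrightarrow> continuous_on A (\<lambda>t. primitive \<tau> w c (f t))"
  unfolding primitive_def by (intro continuous_intros)

lemma mesh_lo_nonneg: "mesh T \<tau> \<Longrightarrow> 0 \<le> lo (\<tau> i)"
  and mesh_hi_le: "mesh T \<tau> \<Longrightarrow> hi (\<tau> i) \<le> T"
  and mesh_lo_less_hi: "mesh T \<tau> \<Longrightarrow> lo (\<tau> i) < hi (\<tau> i)"
proof -
  assume "mesh T \<tau>"
  moreover from this show "lo (\<tau> i) < hi (\<tau> i)" by (simp add: mesh_def)
  ultimately show "0 \<le> lo (\<tau> i)" "hi (\<tau> i) \<le> T" using mesh_subset[of T \<tau> i] by auto
qed

lemma primitive_nonpos: "mesh T \<tau> \<Longrightarrow> t \<le> 0 \<Longrightarrow> primitive \<tau> w c t = 0"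
  by (simp add: primitive_def ramp_nonpos mesh_lo_nonneg)

lemma integral_bcomp_elem_fun:
  assumes "0 \<le> lo e" "lo e < hi e"
  shows "(LINT s:{0..t}|lborel. bcomp c (elem_fun e) s) = (if elem_side e = c then ramp (lo e) (hi e) t else 0)"
  by (simp add: bcomp_elem_fun integral_indicator_eq_ramp assms)

lemma bcomp_pw_const:
  "bcomp c (pw_const \<tau> w) t = (\<Sum>i\<in>UNIV. w $ i * bcomp c (elem_fun (\<tau> i)) t)"
  by (cases c) (simp_all add: pw_const_def)

lemma set_integrable_bcomp_elem_fun:
  "A \<in> sets lborel \<Longrightarrow> set_integrable lborel A (bcomp c (elem_fun e))"
proof -
  assume A: "A \<in> sets lborel"
  have "integrable lborel (bcomp c (elem_fun e))"
    using emeasure_lborel_box_finite[of "lo e" "hi e"] by (simp add: bcomp_elem_fun integrable_indicator_iff)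
  then show ?thesis
    unfolding set_integrable_def using A by (intro integrable_mult_indicator)
qed

lemma integral_bcomp_pw_const:
  assumes "mesh T \<tau>"
  shows "(LINT s:{0..t}|lborel. bcomp c (pw_const \<tau> w) s) = primitive \<tau> w c t"
proof -
  have "(LINT s:{0..t}|lborel. bcomp c (pw_const \<tau> w) s)
      = (\<Sum>i\<in>UNIV. LINT s:{0..t}|lborel. w $ i * bcomp c (elem_fun (\<tau> i)) s)"
    unfolding bcomp_pw_const set_lebesgue_integral_def scaleR_sum_right
    using set_integrable_bcomp_elem_fun[of "{0..t}"]
    by (intro Bochner_Integration.integral_sum) (simp add: set_integrable_def mult.left_commute)
  also have "\<dots> = (\<Sum>i\<in>UNIV. if elem_side (\<tau> i) = c then w $ i * ramp (lo (\<tau> i)) (hi (\<tau> i)) t else 0)"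
    by (intro sum.cong refl)
      (simp add: integral_bcomp_elem_fun mesh_lo_nonneg[OF assms] mesh_lo_less_hi[OF assms])
  also have "\<dots> = primitive \<tau> w c t" by (simp add: primitive_def sum.If_cases)
  finally show ?thesis .
qed

lemma bcomp_single_layer:
  "bcomp c (single_layer L u) t =
    (LINT s:{0..t}|lborel. bcomp c u s) / 2 + (LINT s:{0..t - L}|lborel. bcomp (opposite c) u s) / 2"
  by (cases c) (simp_all add: single_layer_def)

lemma bcomp_single_layer_elem_fun:
  assumes "0 \<le> lo e" "lo e < hi e"
  shows "bcomp c (single_layer L (elem_fun e)) t =
    (if elem_side e = c then ramp (lo e) (hi e) t else 0) / 2
    + (if elem_side e = opposite c then ramp (lo e) (hi e) (t - L) else 0) / 2"
  by (simp only: bcomp_single_layer integral_bcomp_elem_fun[OF assms])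

lemma bcomp_single_layer_pw_const:
  assumes "mesh T \<tau>"
  shows "bcomp c (single_layer L (pw_const \<tau> w)) t =
    primitive \<tau> w c t / 2 + primitive \<tau> w (opposite c) (t - L) / 2"
  by (simp only: bcomp_single_layer integral_bcomp_pw_const[OF assms])

text \<open>Linearity of V on piecewise constants, read off from the closed forms with ramps. It
  lets the matrix-vector product be recognised as integrals of V applied to a single
  function.\<close>

lemma bcomp_single_layer_sum:
  assumes "mesh T \<tau>"
  shows "bcomp c (single_layer L (pw_const \<tau> w)) t
    = (\<Sum>i\<in>UNIV. w $ i * bcomp c (single_layer L (elem_fun (\<tau> i))) t)"
proof -
  have "primitive \<tau> w c t = (\<Sum>i\<in>UNIV. w $ i * (if elem_side (\<tau> i) = c then ramp (lo (\<tau> i)) (hi (\<tau> i)) t else 0))"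
    for c t
    by (simp add: primitive_def sum.If_cases if_distrib[of "\<lambda>x. _ * x"] cong: if_cong)
  then show ?thesis
    unfolding bcomp_single_layer_pw_const[OF assms]
      bcomp_single_layer_elem_fun[OF mesh_lo_nonneg[OF assms] mesh_lo_less_hi[OF assms]]
    by (simp only: sum_divide_distrib sum.distrib[symmetric] distrib_left times_divide_eq_right)
qed

lemma continuous_on_single_layer_elem_fun:
  assumes "0 \<le> lo e" "lo e < hi e"
  shows "continuous_on A (bcomp c (single_layer L (elem_fun e)))"
  unfolding bcomp_single_layer_elem_fun[OF assms, abs_def]
  by (cases "elem_side e = c"; cases "elem_side e = opposite c") (auto intro!: continuous_intros)

lemma continuous_on_single_layer_pw_const:
  assumes "mesh T \<tau>"
  shows "continuous_on A (bcomp c (single_layer L (pw_const \<tau> w)))"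
  unfolding bcomp_single_layer_pw_const[OF assms, abs_def] by (intro continuous_intros) auto

lemma single_layer_matrix_mult:
  assumes mesh: "mesh T \<tau>" and e: "0 \<le> lo (\<tau>' j)" "hi (\<tau>' j) \<le> T"
  shows "(single_layer_matrix L T \<tau> \<tau>' *v w) $ j
    = integral {lo (\<tau>' j)..hi (\<tau>' j)} (bcomp (elem_side (\<tau>' j)) (single_layer L (pw_const \<tau> w)))"
proof -
  let ?I = "{lo (\<tau>' j)<..<hi (\<tau>' j)}"
  let ?c = "elem_side (\<tau>' j)"
  let ?f = "\<lambda>i. bcomp ?c (single_layer L (elem_fun (\<tau> i)))"
  have int: "set_integrable lborel ?I (?f i)" for i
    by (rule set_integrable_subset[OF borel_integrable_atLeastAtMost'[where a = "lo (\<tau>' j)" and b = "hi (\<tau>' j)",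
            OF continuous_on_single_layer_elem_fun[OF mesh_lo_nonneg[OF mesh] mesh_lo_less_hi[OF mesh]]]]) auto
  have "(single_layer_matrix L T \<tau> \<tau>' *v w) $ j = (\<Sum>i\<in>UNIV. w $ i * (LINT t:?I|lborel. ?f i t))"
    by (simp add: matrix_vector_mult_def single_layer_matrix_def Sigma_inner_elem_fun[OF e] mult.commute)
  also have "\<dots> = (\<Sum>i\<in>UNIV. LINT t:?I|lborel. w $ i * ?f i t)" by simp
  also have "\<dots> = (LINT t:?I|lborel. (\<Sum>i\<in>UNIV. w $ i * ?f i t))"
    unfolding set_lebesgue_integral_def scaleR_sum_right
    using int
    by (intro Bochner_Integration.integral_sum[symmetric]) (simp add: set_integrable_def mult.left_commute)
  also have "\<dots> = (LINT t:?I|lborel. bcomp ?c (single_layer L (pw_const \<tau> w)) t)"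
    by (simp only: bcomp_single_layer_sum[OF mesh])
  also have "\<dots> = integral {lo (\<tau>' j)..hi (\<tau>' j)} (bcomp ?c (single_layer L (pw_const \<tau> w)))"
  proof -
    have "set_integrable lborel ?I (bcomp ?c (single_layer L (pw_const \<tau> w)))"
      by (rule set_integrable_subset[OF borel_integrable_atLeastAtMost'[OF
              continuous_on_single_layer_pw_const[OF mesh]], of _ "lo (\<tau>' j)" "hi (\<tau>' j)"]) auto
    then show ?thesis by (simp add: set_borel_integral_eq_integral integral_open_interval_real)
  qed
  finally show ?thesis .
qed

text \<open>Different fine elements either lie on different sides or are disjoint, so the mass
  matrix is diagonal with the element lengths as entries. Injectivity of the fine family excludes
  that one element occurs under two indices.\<close>

lemma mass_matrix_refinement:
  assumes mesh: "mesh T \<tau>" and ref: "equal_refinement m \<tau> \<tau>'"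
  shows "mass_matrix T \<tau>' $ j $ k = (if j = k then hi (\<tau>' j) - lo (\<tau>' j) else 0)"
    and "0 \<le> lo (\<tau>' j)" "lo (\<tau>' j) < hi (\<tau>' j)" "hi (\<tau>' j) \<le> T"
proof -
  have sub: "\<exists>i r. r < m \<and> \<tau>' j = subelem m (\<tau> i) r" for j
    using ref unfolding equal_refinement_def by blast
  have bounds: "0 \<le> lo (\<tau>' j) \<and> lo (\<tau>' j) < hi (\<tau>' j) \<and> hi (\<tau>' j) \<le> T" for j
  proof -
    obtain i r where "r < m" "\<tau>' j = subelem m (\<tau> i) r" using sub by blast
    then show ?thesis
      using subelem_bounds[OF mesh_lo_less_hi[OF mesh], of r m i] mesh_lo_nonneg[OF mesh, of i] mesh_hi_le[OF mesh, of i]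
      by (simp del: subelem_simps)
  qed
  then show "0 \<le> lo (\<tau>' j)" "lo (\<tau>' j) < hi (\<tau>' j)" "hi (\<tau>' j) \<le> T" by blast+
  have "mass_matrix T \<tau>' $ j $ k = (LINT t:{lo (\<tau>' j)<..<hi (\<tau>' j)}|lborel. bcomp (elem_side (\<tau>' j)) (elem_fun (\<tau>' k)) t)"
    using bounds[of j] by (simp add: mass_matrix_def Sigma_inner_elem_fun)
  also have "\<dots> = (if j = k then hi (\<tau>' j) - lo (\<tau>' j) else 0)"
  proof (cases "elem_side (\<tau>' j) = elem_side (\<tau>' k)")
    case True
    have "(LINT t:{lo (\<tau>' j)<..<hi (\<tau>' j)}|lborel. bcomp (elem_side (\<tau>' j)) (elem_fun (\<tau>' k)) t)
        = measure lborel ({lo (\<tau>' j)<..<hi (\<tau>' j)} \<inter> {lo (\<tau>' k)<..<hi (\<tau>' k)})"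
      using True by (simp add: bcomp_elem_fun set_lebesgue_integral_def indicator_inter_arith[symmetric] del: Int_greaterThanLessThan)
    also have "\<dots> = (if j = k then hi (\<tau>' j) - lo (\<tau>' j) else 0)"
    proof (cases "j = k")
      case True
      then show ?thesis using bounds[of k] by simp
    next
      case False
      have "{lo (\<tau>' j)<..<hi (\<tau>' j)} \<inter> {lo (\<tau>' k)<..<hi (\<tau>' k)} = {}"
      proof (rule ccontr)
        assume "{lo (\<tau>' j)<..<hi (\<tau>' j)} \<inter> {lo (\<tau>' k)<..<hi (\<tau>' k)} \<noteq> {}"
        then obtain t where t: "t \<in> {lo (\<tau>' j)<..<hi (\<tau>' j)}" "t \<in> {lo (\<tau>' k)<..<hi (\<tau>' k)}" by blast
        obtain i r i' r' where *: "r < m" "\<tau>' j = subelem m (\<tau> i) r" "r' < m" "\<tau>' k = subelem m (\<tau> i') r'"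
          using sub by meson
        have "elem_side (\<tau> i) = elem_side (\<tau> i')" using \<open>elem_side (\<tau>' j) = _\<close> * by simp
        then have "i = i' \<and> r = r'"
          using subelem_overlap_imp_eq[OF mesh *(1,3)] t unfolding *(2,4) by blast
        then have "\<tau>' j = \<tau>' k" using * by simp
        then show False using False ref by (auto simp: equal_refinement_def dest: injD)
      qed
      then show ?thesis using False by (simp only:) simp
    qed
    finally show ?thesis .
  next
    case False
    then show ?thesis by (auto simp: bcomp_elem_fun)
  qed
  finally show "mass_matrix T \<tau>' $ j $ k = (if j = k then hi (\<tau>' j) - lo (\<tau>' j) else 0)" .
qed

lemma schur_matrix_quadratic_form:
  assumes mesh: "mesh T \<tau>" and ref: "equal_refinement m \<tau> \<tau>'"
  shows "(schur_matrix L T \<tau> \<tau>' *v w) \<bullet> w =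
    (\<Sum>i\<in>UNIV. \<Sum>r<m.
      (integral {lo (subelem m (\<tau> i) r)..hi (subelem m (\<tau> i) r)}
        (bcomp (elem_side (\<tau> i)) (single_layer L (pw_const \<tau> w))))\<^sup>2
      / (hi (subelem m (\<tau> i) r) - lo (subelem m (\<tau> i) r)))"
proof -
  let ?V = "single_layer_matrix L T \<tau> \<tau>'"
  let ?G = "\<lambda>e. (integral {lo e..hi e} (bcomp (elem_side e) (single_layer L (pw_const \<tau> w))))\<^sup>2 / (hi e - lo e)"
  note fine = mass_matrix_refinement[OF mesh ref]
  have "(schur_matrix L T \<tau> \<tau>' *v w) \<bullet> w = w \<bullet> (transpose ?V *v (matrix_inv (mass_matrix T \<tau>') *v (?V *v w)))"
    by (simp add: schur_matrix_def matrix_vector_mul_assoc matrix_mul_assoc inner_commute)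
  \<comment> \<open>The transpose moves to the other factor, which leaves the quadratic form of the
    inverse mass matrix at the vector of cell integrals.\<close>
  also have "\<dots> = (matrix_inv (mass_matrix T \<tau>') *v (?V *v w)) \<bullet> (?V *v w)"
    by (metis dot_lmul_matrix inner_commute vector_transpose_matrix transpose_transpose)
  also have "\<dots> = (\<Sum>k\<in>UNIV. ((?V *v w) $ k)\<^sup>2 / (hi (\<tau>' k) - lo (\<tau>' k)))"
    by (rule matrix_inv_diagonal_quadratic_form) (use fine in \<open>auto simp: less_imp_neq[symmetric]\<close>)
  also have "\<dots> = (\<Sum>k\<in>UNIV. ?G (\<tau>' k))"
    by (intro sum.cong refl) (simp add: single_layer_matrix_mult[OF mesh fine(2,4)])
  also have "\<dots> = (\<Sum>i\<in>UNIV. \<Sum>r<m. ?G (subelem m (\<tau> i) r))"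
    by (rule sum_equal_refinement[OF mesh ref])
  finally show ?thesis by (simp only: subelem_simps(1))
qed

lemma schur_matrix_quadratic_form_ge:
  fixes \<tau> :: "'i::finite \<Rightarrow> elem" and \<tau>' :: "'k::finite \<Rightarrow> elem" and w :: "real^'i"
  assumes mesh: "mesh T \<tau>" and ref: "equal_refinement m \<tau> \<tau>'" and m: "m > 0"
    and d: "\<And>i. hi (\<tau> i) - lo (\<tau> i) = d" and L: "L = real l * d"
  defines "f \<equiv> \<lambda>c. bcomp c (single_layer L (pw_const \<tau> w))"
  shows "(1 - 1 / (real m)\<^sup>2) * (integral {0..T} (\<lambda>t. (f At_0 t)\<^sup>2) + integral {0..T} (\<lambda>t. (f At_L t)\<^sup>2))
    \<le> (schur_matrix L T \<tau> \<tau>' *v w) \<bullet> w"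
proof -
  have d0: "d > 0" using mesh_lo_less_hi[OF mesh] d by (metis diff_gt_0_iff_gt)
  have prim: "grid_affine d (primitive \<tau> w c)" for c
    unfolding primitive_def[abs_def]
  proof (intro grid_affine_sum grid_affine_cmult)
    fix i
    obtain p :: nat where p: "lo (\<tau> i) = real p * d" using uniform_mesh_lo_multiple[OF mesh d] by blast
    then have "hi (\<tau> i) = real_of_int (int p + 1) * d" using d[of i] by (simp add: algebra_simps)
    then show "grid_affine d (ramp (lo (\<tau> i)) (hi (\<tau> i)))"
      using grid_affine_ramp[OF d0, of "int p"] p by simp
  qed
  have f_affine: "grid_affine d (f c)" for c
  proof -
    \<comment> \<open>As L = l d, the delay is a shift by l whole cells.\<close>
    have "grid_affine d (\<lambda>t. (1/2) * primitive \<tau> w c t + (1/2) * primitive \<tau> w (opposite c) (t - of_int (int l) * d))"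
      by (intro grid_affine_add grid_affine_cmult grid_affine_shift prim)
    moreover have "f c = (\<lambda>t. (1/2) * primitive \<tau> w c t + (1/2) * primitive \<tau> w (opposite c) (t - of_int (int l) * d))"
      by (rule ext) (simp add: f_def bcomp_single_layer_pw_const[OF mesh] L)
    ultimately show ?thesis by simp
  qed
  have cont: "continuous_on A (f c)" for A c
    unfolding f_def by (rule continuous_on_single_layer_pw_const[OF mesh])
  define q where "q = 1 - 1 / (real m)\<^sup>2"
  define I where "I = (\<lambda>i. integral {lo (\<tau> i)..hi (\<tau> i)} (\<lambda>t. (f (elem_side (\<tau> i)) t)\<^sup>2))"
  have q: "0 \<le> q" using m by (simp add: q_def power_le_one_iff)
  have part: "integral {0..T} (\<lambda>t. (f c t)\<^sup>2) \<le> (\<Sum>i | elem_side (\<tau> i) = c. I i)" for c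
  proof -
    have "integral {0..T} (\<lambda>t. (f c t)\<^sup>2) \<le> (\<Sum>i | elem_side (\<tau> i) = c. integral {lo (\<tau> i)..hi (\<tau> i)} (\<lambda>t. (f c t)\<^sup>2))"
      by (rule mesh_integral_le[OF mesh]) (auto intro!: continuous_intros cont)
    also have "\<dots> = (\<Sum>i | elem_side (\<tau> i) = c. I i)" by (intro sum.cong) (auto simp: I_def)
    finally show ?thesis .
  qed
  have "q * (integral {0..T} (\<lambda>t. (f At_0 t)\<^sup>2) + integral {0..T} (\<lambda>t. (f At_L t)\<^sup>2))
      \<le> q * ((\<Sum>i | elem_side (\<tau> i) = At_0. I i) + (\<Sum>i | elem_side (\<tau> i) = At_L. I i))"
    by (intro mult_left_mono add_mono q part)
  also have "\<dots> = (\<Sum>i\<in>UNIV. q * I i)"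
    by (simp only: sum_UNIV_by_side[of I "\<lambda>i. elem_side (\<tau> i)", symmetric] sum_distrib_left)
  also have "\<dots> \<le> (\<Sum>i\<in>UNIV. \<Sum>r<m.
      (integral {lo (subelem m (\<tau> i) r)..hi (subelem m (\<tau> i) r)} (f (elem_side (\<tau> i))))\<^sup>2
      / (hi (subelem m (\<tau> i) r) - lo (subelem m (\<tau> i) r)))"
  proof (rule sum_mono)
    fix i
    obtain p :: nat where p: "lo (\<tau> i) = real p * d" using uniform_mesh_lo_multiple[OF mesh d] by blast
    then have hi: "hi (\<tau> i) = real_of_int (int p + 1) * d" using d[of i] by (simp add: algebra_simps)
    have lo: "lo (\<tau> i) = real_of_int (int p) * d" using p by simp
    \<comment> \<open>Element i is exactly the grid cell with number \<open>int p\<close>, so a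
      single affine formula is valid on all of it.\<close>
    obtain \<alpha> \<beta> where "\<forall>t\<in>{lo (\<tau> i)..hi (\<tau> i)}. f (elem_side (\<tau> i)) t = \<alpha> + \<beta> * t"
      using f_affine unfolding grid_affine_def lo hi by meson
    then have "q * I i \<le> (\<Sum>r<m. (integral {lo (\<tau> i) + real r * (d / real m)..lo (\<tau> i) + real (Suc r) * (d / real m)}
        (f (elem_side (\<tau> i))))\<^sup>2 / (d / real m))"
      unfolding q_def I_def using m d[of i]
      by (intro affine_cell_averages[of _ _ _ \<alpha> \<beta>] mesh_lo_less_hi[OF mesh]) auto
    also have "\<dots> = (\<Sum>r<m. (integral {lo (subelem m (\<tau> i) r)..hi (subelem m (\<tau> i) r)} (f (elem_side (\<tau> i))))\<^sup>2
      / (hi (subelem m (\<tau> i) r) - lo (subelem m (\<tau> i) r)))"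
    proof (intro sum.cong refl)
      fix r
      have "hi (subelem m (\<tau> i) r) - lo (subelem m (\<tau> i) r) = d / real m"
        using d[of i] by (simp add: algebra_simps add_divide_distrib)
      then show "(integral {lo (\<tau> i) + real r * (d / real m)..lo (\<tau> i) + real (Suc r) * (d / real m)}
        (f (elem_side (\<tau> i))))\<^sup>2 / (d / real m)
        = (integral {lo (subelem m (\<tau> i) r)..hi (subelem m (\<tau> i) r)} (f (elem_side (\<tau> i))))\<^sup>2
          / (hi (subelem m (\<tau> i) r) - lo (subelem m (\<tau> i) r))"
        by (simp only: subelem_simps d)
    qed
    finally show "q * I i \<le> (\<Sum>r<m. (integral {lo (subelem m (\<tau> i) r)..hi (subelem m (\<tau> i) r)} (f (elem_side (\<tau> i))))\<^sup>2
      / (hi (subelem m (\<tau> i) r) - lo (subelem m (\<tau> i) r)))" .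
  qed
  also have "\<dots> = (schur_matrix L T \<tau> \<tau>' *v w) \<bullet> w"
    unfolding f_def by (rule schur_matrix_quadratic_form[OF mesh ref, symmetric])
  finally show ?thesis unfolding q_def .
qed

lemma dual_norm_pw_const_le:
  assumes T: "T > 0" and mesh: "mesh T \<tau>"
  shows "(dual_norm T (Sigma_inner T (pw_const \<tau> w)))\<^sup>2
    \<le> integral {0..T} (\<lambda>t. (primitive \<tau> w At_0 t)\<^sup>2 + (primitive \<tau> w At_L t)\<^sup>2)"
proof -
  define U where "U = (primitive \<tau> w At_0, primitive \<tau> w At_L)"
  have cont: "continuous_on A (primitive \<tau> w c)" for A c
    by (intro continuous_on_primitive continuous_on_id)
  have int: "set_integrable lborel {0<..<T} (bcomp c (pw_const \<tau> w))" for c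
    unfolding bcomp_pw_const[abs_def] using set_integrable_bcomp_elem_fun[of "{0<..<T}" c]
    unfolding set_integrable_def scaleR_sum_right
    by (intro Bochner_Integration.integrable_sum) (simp add: mult.left_commute)
  have "(dual_norm T (Sigma_inner T (bcomp At_0 (pw_const \<tau> w), bcomp At_L (pw_const \<tau> w))))\<^sup>2 \<le> Sigma_inner T U U"
  proof (rule dual_norm_le_primitive[OF T int int])
    show "U = (\<lambda>t. LINT s:{0..t}|lborel. bcomp At_0 (pw_const \<tau> w) s, \<lambda>t. LINT s:{0..t}|lborel. bcomp At_L (pw_const \<tau> w) s)"
      unfolding integral_bcomp_pw_const[OF mesh] U_def ..
    show "U \<in> L2 T \<times> L2 T" by (auto simp: U_def intro!: continuous_on_imp_L2 cont)
  qed
  moreover have "Sigma_inner T U U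
      = integral {0..T} (\<lambda>t. (primitive \<tau> w At_0 t)\<^sup>2 + (primitive \<tau> w At_L t)\<^sup>2)"
    by (simp add: Sigma_inner_def U_def L2_inner_continuous[OF cont cont] power2_eq_square)
      (intro integral_add[symmetric] integrable_continuous_real continuous_intros cont)
  ultimately show ?thesis by simp
qed

theorem theorem3p2:
  fixes L T :: real and n m :: nat
    and \<tau>H :: "'i::finite \<Rightarrow> elem" and \<tau>h :: "'k::finite \<Rightarrow> elem"
    and w :: "real^'i"
  assumes "L > 0" and "n \<ge> 1" and "T = real n * L"
    and "uniform_mesh T \<tau>H"
    and "m > 2" and "equal_refinement m \<tau>H \<tau>h"
    and "\<forall>c. \<forall>j\<le>n. real j * L \<in> mesh_nodes \<tau>H c"
  shows "(schur_matrix L T \<tau>H \<tau>h *v w) \<bullet> w \<ge>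
           4 * (sin (pi / (2 * (2 * real n + 1))))\<^sup>2 * (1/2 - 1 / real m)\<^sup>2
             * (dual_norm T (Sigma_inner T (pw_const \<tau>H w)))\<^sup>2"
proof -
  obtain d where mesh: "mesh T \<tau>H" and d: "\<And>i. hi (\<tau>H i) - lo (\<tau>H i) = d"
    using assms(4) by (auto simp: uniform_mesh_def)
  have T: "T > 0" using assms(1-3) by simp
  \<comment> \<open>The node with j = 1 exists because n >= 1. It is an end of some element, hence L
    is an integer multiple of d.\<close>
  have "L \<in> mesh_nodes \<tau>H At_0" using assms(2,7) by (metis mult_1 of_nat_1)
  then obtain i where i: "L = lo (\<tau>H i) \<or> L = hi (\<tau>H i)" by (auto simp: mesh_nodes_def)
  obtain p :: nat where p: "lo (\<tau>H i) = real p * d" using uniform_mesh_lo_multiple[OF mesh d] by blast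
  then have "hi (\<tau>H i) = real (Suc p) * d" using d[of i] by (simp add: algebra_simps)
  then obtain l :: nat where l: "L = real l * d" using i p by metis
  define f where "f = (\<lambda>c. bcomp c (single_layer L (pw_const \<tau>H w)))"
  define s where "s = (sin (pi / (2 * (2 * real n + 1))))\<^sup>2"
  define D where "D = (dual_norm T (Sigma_inner T (pw_const \<tau>H w)))\<^sup>2"
  define F where "F = integral {0..T} (\<lambda>t. (f At_0 t)\<^sup>2) + integral {0..T} (\<lambda>t. (f At_L t)\<^sup>2)"
  have cont: "continuous_on A (f c)" for A c
    unfolding f_def by (rule continuous_on_single_layer_pw_const[OF mesh])
  have "s * D \<le> s * integral {0..T} (\<lambda>t. (primitive \<tau>H w At_0 t)\<^sup>2 + (primitive \<tau>H w At_L t)\<^sup>2)"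
    unfolding D_def s_def by (intro mult_left_mono dual_norm_pw_const_le[OF T mesh]) simp
  also have "\<dots> \<le> integral {0..T} (\<lambda>t. (f At_0 t)\<^sup>2 + (f At_L t)\<^sup>2)"
    unfolding f_def bcomp_single_layer_pw_const[OF mesh] opposite.simps s_def assms(3)
    by (rule square_integral_slices_ge)
      (auto intro!: continuous_intros primitive_nonpos[OF mesh] assms(1))
  also have "\<dots> = F"
    unfolding F_def by (intro integral_add integrable_continuous_real continuous_intros cont)
  finally have sD: "s * D \<le> F" .
  have "0 \<le> s * D" by (simp add: s_def D_def)
  define x where "x = 1 / real m"
  have x: "0 < x" "x \<le> 1/2" using assms(5) by (simp_all add: x_def field_simps)
  \<comment> \<open>1 - x^2 - (1 - 2 x)^2 = 4 x - 5 x^2, and x^2 <= x/2 makes this nonnegative. The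
    bound x <= 1/2 comes from m > 2.\<close>
  have "x * x \<le> x * (1/2)" using x by (intro mult_left_mono) auto
  then have "4 * (1/2 - x)\<^sup>2 \<le> 1 - x\<^sup>2" using x by (simp add: power2_eq_square algebra_simps)
  then have "4 * (1/2 - x)\<^sup>2 * (s * D) \<le> (1 - x\<^sup>2) * F"
    using sD \<open>0 \<le> s * D\<close> x by (intro mult_mono) (auto simp: power_le_one_iff abs_square_le_1)
  also have "\<dots> \<le> (schur_matrix L T \<tau>H \<tau>h *v w) \<bullet> w"
    using schur_matrix_quadratic_form_ge[OF mesh assms(6) _ d l, of w] assms(5)
    by (simp add: F_def f_def x_def power_divide)
  finally show ?thesis by (simp add: s_def D_def x_def mult_ac)
qed

end
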